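(* For each of the following classes of graphs, the algebraic connectivity of a token graph $F_k(G)$ equals the algebraic connectivity of $G$. (i) Let $G=K_n$ be the complete graph on $n$ vertices. Then $\alpha(F_k(G))=\alpha(G)=n$ for every $n$ and $k=1,\dots,n-1$. (ii) Let $G=S_n=K_{1,n-1}$ be the star graph on $n$ vertices. Then $\alpha(F_k(G))=\alpha(G)=1$ for every $n$ and $k=1,\dots,n-1$. (iii) Let $G=P_n$ be the path graph on $n$ vertices. Then $\alpha(F_k(G))=\alpha(G)=2(1-\cos(\pi/n))$ for every $n$ and $k=1,\dots,n-1$. (iv) Let $G=K_{n_1,n_2}$ be the complete bipartite graph on $n=n_1+n_2$ vertices, with $n_1\le n_2$. Then $\alpha(F_k(G))=\alpha(G)=n_1$ for every $n_1,n_2$ and $k=1,\dots,n-1$.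
   Context: All graphs are finite and simple. For a graph $G$ with vertex set $[n]=\{1,\dots,n\}$ and an integer $k$ with $1\le k\le n$, the $k$-token graph $F_k(G)$ has as vertices the $k$-subsets of $[n]$; two vertices $A,B$ are adjacent whenever their symmetric difference $A\bigtriangleup B$ is a pair $\{a,b\}$ with $a\in A$, $b\in B$ and $\{a,b\}$ an edge of $G$. The Laplacian matrix of a graph is the diagonal matrix of vertex degrees minus the adjacency matrix. The algebraic connectivity $\alpha(G)$ of a graph $G$ is the second smallest eigenvalue (counted with multiplicity) of its Laplacian matrix $L$; equivalently, $\alpha(G)=\min\{ v^{\top}Lv/v^{\top}v : v\ne 0,\ v^{\top}\mathbf 1=0\}$, where $\mathbf 1$ is the all-ones vector.
   Formalization: The value "=1" in (ii) is not claimed for n=2, nor "=n_1" in (iv) for n_1=n_2=1, since S_2=K_{1,1}=K_2 has algebraic connectivity 2; the equality α(F_k(G))=α(G) is still claimed there. In (iv) both parts are nonempty (n_1≥1). *)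

theory Defs
  imports
    "Graph_Theory.Graph_Theory"
    "Jordan_Normal_Form.Char_Poly"
    Complex_Main
begin

text \<open>
  A finite simple graph is a \<^typ>\<open>'a pair_pre_digraph\<close> satisfying \<^locale>\<open>pair_graph\<close>: finite, loop-free,
  with a symmetric arc relation in which the undirected edge \<open>{u, v}\<close> is the pair of arcs
  \<open>(u, v)\<close>, \<open>(v, u)\<close>. Hence the degree of a vertex is its out-degree.
\<close>

definition token_graph :: "nat \<Rightarrow> 'a pair_pre_digraph \<Rightarrow> 'a set pair_pre_digraph" where
  "token_graph k G =
     \<lparr> pverts = {A. A \<subseteq> pverts G \<and> card A = k},
       parcs = {(A, B). A \<subseteq> pverts G \<and> card A = k \<and> B \<subseteq> pverts G \<and> card B = k \<and>
                  (\<exists>a\<in>A. \<exists>b\<in>B. sym_diff A B = {a, b} \<and> (a, b) \<in> parcs G)} \<rparr>"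

text \<open>The matrices below are relative to an enumeration \<open>vs\<close> of the vertex set.\<close>

definition degree_matrix :: "'a pair_pre_digraph \<Rightarrow> 'a list \<Rightarrow> real mat" where
  "degree_matrix G vs = mat_diag (length vs) (\<lambda>i. real (out_degree (with_proj G) (vs ! i)))"

definition adjacency_matrix :: "'a pair_pre_digraph \<Rightarrow> 'a list \<Rightarrow> real mat" where
  "adjacency_matrix G vs =
     mat (length vs) (length vs) (\<lambda>(i, j). if (vs ! i, vs ! j) \<in> parcs G then 1 else 0)"

definition laplacian_matrix :: "'a pair_pre_digraph \<Rightarrow> 'a list \<Rightarrow> real mat" where
  "laplacian_matrix G vs = degree_matrix G vs - adjacency_matrix G vs"

text \<open>
  The eigenvalues with multiplicity, in increasing order. A different enumeration of the vertices
  conjugates the Laplacian by a permutation matrix, so the spectrum does not depend on the choice.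
  The Laplacian is real symmetric, so no complex roots are lost by taking real roots, and the
  algebraic and geometric multiplicities agree.
\<close>

definition laplacian_spectrum :: "'a pair_pre_digraph \<Rightarrow> real list" where
  "laplacian_spectrum G =
     (let vs = (SOME vs. distinct vs \<and> set vs = pverts G)
      in sorted_list_of_multiset (proots (char_poly (laplacian_matrix G vs))))"

text \<open>Only meaningful for graphs with at least two vertices.\<close>

definition algebraic_connectivity :: "'a pair_pre_digraph \<Rightarrow> real" where
  "algebraic_connectivity G = laplacian_spectrum G ! 1"

definition complete_graph :: "nat \<Rightarrow> nat pair_pre_digraph" where
  "complete_graph n = \<lparr> pverts = {1..n}, parcs = {(u, v). u \<in> {1..n} \<and> v \<in> {1..n} \<and> u \<noteq> v} \<rparr>"

definition path_graph :: "nat \<Rightarrow> nat pair_pre_digraph" where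
  "path_graph n =
     \<lparr> pverts = {1..n}, parcs = {(u, v). u \<in> {1..n} \<and> v \<in> {1..n} \<and> (v = u + 1 \<or> u = v + 1)} \<rparr>"

definition complete_bipartite_graph :: "nat \<Rightarrow> nat \<Rightarrow> nat pair_pre_digraph" where
  "complete_bipartite_graph m n =
     \<lparr> pverts = {1..m + n},
       parcs = {1..m} \<times> {m + 1..m + n} \<union> {m + 1..m + n} \<times> {1..m} \<rparr>"

definition star_graph :: "nat \<Rightarrow> nat pair_pre_digraph" where
  "star_graph n = complete_bipartite_graph 1 (n - 1)"

lemma complete_digraph_complete_graph: "complete_digraph n (with_proj (complete_graph n))"
  unfolding complete_digraph_pair_def by (auto simp: complete_graph_def)

lemma complete_bipartite_digraph_complete_bipartite_graph:
  "complete_bipartite_digraph m n (with_proj (complete_bipartite_graph m n))"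
  unfolding complete_bipartite_digraph_pair_def
proof (intro conjI exI)
  show "pverts (complete_bipartite_graph m n) = {1..m} \<union> {m + 1..m + n}"
    by (auto simp: complete_bipartite_graph_def)
qed (simp_all add: complete_bipartite_graph_def)

lemma pair_graph_path_graph: "pair_graph (path_graph n)"
proof -
  have "parcs (path_graph n) \<subseteq> {1..n} \<times> {1..n}"
    by (auto simp: path_graph_def)
  then have "finite (parcs (path_graph n))"
    by (rule finite_subset) simp
  then show ?thesis
    by unfold_locales (auto simp: path_graph_def symmetric_def intro: symI)
qed

lemma pair_graph_token_graph:
  assumes "pair_graph G"
  shows "pair_graph (token_graph k G)"
proof -
  interpret pair_graph G by fact
  have fin: "finite (pverts (token_graph k G))"
    by (auto simp: token_graph_def)
  have "parcs (token_graph k G) \<subseteq> pverts (token_graph k G) \<times> pverts (token_graph k G)"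
    by (auto simp: token_graph_def)
  then have "finite (parcs (token_graph k G))"
    by (rule finite_subset) (simp add: fin)
  moreover have "sym (parcs (token_graph k G))"
  proof (rule symI)
    fix A B assume AB: "(A, B) \<in> parcs (token_graph k G)"
    then obtain a b where ab: "a \<in> A" "b \<in> B" "sym_diff A B = {a, b}" "(a, b) \<in> parcs G"
      by (auto simp: token_graph_def)
    have "(b, a) \<in> parcs G"
      using sym_arcs ab(4) unfolding symmetric_def with_proj_simps by (rule symD)
    moreover have "sym_diff B A = {b, a}"
      using ab(3) by blast
    ultimately show "(B, A) \<in> parcs (token_graph k G)"
      using AB ab(1,2) unfolding token_graph_def by auto
  qed
  moreover have "fst e \<in> pverts (token_graph k G)" "snd e \<in> pverts (token_graph k G)"
    "fst e \<noteq> snd e" if "e \<in> parcs (token_graph k G)" for e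
    using that by (simp_all add: token_graph_def case_prod_unfold) blast
  ultimately show ?thesis
    using fin by unfold_locales (simp_all add: symmetric_def)
qed

end

theory Submission
  imports Defs
begin

text \<open>
  By the min-max principle it suffices to exhibit an eigenfunction of \<open>G\<close> for the claimed value \<open>\<kappa>\<close> and to
  prove the Poincare inequality \<open>\<kappa> * (\<Sum>f\<^sup>2) \<le> D(f)\<close> for functions of zero sum on the token graph, where
  \<open>D\<close> is the Dirichlet form. A function on the \<open>k\<close>-sets splits orthogonally into the lift
  \<open>A \<mapsto> (\<Sum>a\<in>A. u a)\<close> of a function \<open>u\<close> on the vertices, for which the inequality is that of \<open>G\<close>, and a
  remainder \<open>w\<close> with \<open>(\<Sum>A\<ni>a. w A) = 0\<close> for all vertices \<open>a\<close>. The latter is treated by induction on the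
  number of vertices: for every vertex \<open>c\<close>, the restrictions of \<open>w\<close> to the sets containing \<open>c\<close> and to those
  avoiding \<open>c\<close> have zero sum on token graphs of \<open>G - c\<close>. For paths one deletes an end vertex, as \<open>\<kappa>\<close>
  decreases with the length. For complete and complete bipartite graphs one averages over all \<open>c\<close>.
\<close>

subsection \<open>The Dirichlet form and the algebraic connectivity\<close>

definition laplacian :: "'a pair_pre_digraph \<Rightarrow> ('a \<Rightarrow> real) \<Rightarrow> 'a \<Rightarrow> real" where
  "laplacian G f x = (\<Sum>y | (x, y) \<in> parcs G. f x - f y)"

text \<open>The halving compensates for every undirected edge being present as two arcs.\<close>

definition dirichlet_form :: "'a pair_pre_digraph \<Rightarrow> ('a \<Rightarrow> real) \<Rightarrow> real" where
  "dirichlet_form G f = (\<Sum>(x, y)\<in>parcs G. (f x - f y)\<^sup>2) / 2"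

text \<open>A lower bound for the Rayleigh quotient on the complement of the constants. Phrased
  without matrices, it passes to token graphs and to vertex-deleted graphs without any choice of
  enumeration.\<close>

definition poincare :: "'a pair_pre_digraph \<Rightarrow> real \<Rightarrow> bool" where
  "poincare G \<kappa> \<longleftrightarrow>
     (\<forall>f. sum f (pverts G) = 0 \<longrightarrow> \<kappa> * (\<Sum>x\<in>pverts G. (f x)\<^sup>2) \<le> dirichlet_form G f)"

lemma poincareI:
  assumes "\<And>f. sum f (pverts G) = 0 \<Longrightarrow>
             \<kappa> * (\<Sum>x\<in>pverts G. (f x)\<^sup>2) \<le> dirichlet_form G f"
  shows "poincare G \<kappa>"
  using assms by (simp add: poincare_def)

lemma poincareD:
  "poincare G \<kappa> \<Longrightarrow> sum f (pverts G) = 0 \<Longrightarrow>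
     \<kappa> * (\<Sum>x\<in>pverts G. (f x)\<^sup>2) \<le> dirichlet_form G f"
  by (simp add: poincare_def)

lemma dirichlet_form_nonneg: "0 \<le> dirichlet_form G f"
  unfolding dirichlet_form_def by (auto intro!: sum_nonneg divide_nonneg_nonneg)

lemma poincare_antimono:
  fixes G :: "'a pair_pre_digraph"
  assumes "poincare G \<nu>" "\<kappa> \<le> \<nu>"
  shows "poincare G \<kappa>"
proof (rule poincareI)
  fix f :: "'a \<Rightarrow> real" assume "sum f (pverts G) = 0"
  then show "\<kappa> * (\<Sum>x\<in>pverts G. (f x)\<^sup>2) \<le> dirichlet_form G f"
    by (intro order_trans[OF mult_right_mono[OF assms(2)] poincareD[OF assms(1)]]) (auto intro: sum_nonneg)
qed

text \<open>A zero-sum function on at most one vertex vanishes. This settles the degenerate token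
  graphs that appear in the inductions.\<close>

lemma poincare_trivial:
  fixes G :: "'a pair_pre_digraph"
  assumes "card (pverts G) \<le> 1"
  shows "poincare G \<kappa>"
proof (rule poincareI)
  fix f :: "'a \<Rightarrow> real" assume f: "sum f (pverts G) = 0"
  have "(\<Sum>x\<in>pverts G. (f x)\<^sup>2) = 0"
  \<comment> \<open>Cardinality 0 includes infinite vertex sets, over which sums are 0 by
    convention.\<close>
  proof (cases "card (pverts G) = 0")
    case False
    with assms obtain x where "pverts G = {x}"
      using card_1_singletonE by (metis le_antisym less_one not_le)
    with f show ?thesis by simp
  qed (auto simp: card_eq_0_iff)
  then show "\<kappa> * (\<Sum>x\<in>pverts G. (f x)\<^sup>2) \<le> dirichlet_form G f"
    by (simp add: dirichlet_form_nonneg)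
qed

lemma laplacian_matrix_carrier:
  "laplacian_matrix G vs \<in> carrier_mat (length vs) (length vs)"
  unfolding laplacian_matrix_def degree_matrix_def adjacency_matrix_def
  by (intro minus_carrier_mat) simp

lemma out_degree_eq: "out_degree (with_proj G) x = card {y. (x, y) \<in> parcs G}"
  unfolding out_degree_def out_arcs_def
  by (rule bij_betw_same_card[of snd]) (force simp: bij_betw_def inj_on_def image_iff)

lemma laplacian_eq_degree:
  "laplacian G f x = real (out_degree (with_proj G) x) * f x - (\<Sum>y | (x, y) \<in> parcs G. f y)"
  by (simp add: laplacian_def sum_subtractf out_degree_eq)

section \<open>Green's formula and Rayleigh quotients of eigenfunctions\<close>

context pair_graph
begin

lemma arc_sym: "(x, y) \<in> parcs G \<Longrightarrow> (y, x) \<in> parcs G"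
  using sym_arcs unfolding symmetric_def with_proj_simps by (rule symD)

lemma arcs_Sigma: "parcs G = (SIGMA x:pverts G. {y. (x, y) \<in> parcs G})"
  by (auto dest: in_arcsD1)

lemma finite_neighbours: "finite {y. (x, y) \<in> parcs G}"
  by (rule finite_subset[OF _ pair_finite_verts]) (auto dest: in_arcsD2)

lemma sum_arcs: "(\<Sum>(x, y)\<in>parcs G. h x y) = (\<Sum>x\<in>pverts G. \<Sum>y | (x, y) \<in> parcs G. h x y)"
  by (subst arcs_Sigma, rule sum.Sigma[symmetric]) (auto simp: pair_finite_verts finite_neighbours)

lemma sum_arcs_swap: "(\<Sum>(x, y)\<in>parcs G. h x y) = (\<Sum>(x, y)\<in>parcs G. h y x)"
  by (rule sum.reindex_bij_witness[of _ prod.swap prod.swap]) (auto intro: arc_sym)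

text \<open>Summation by parts: reversing all arcs turns the terms weighted by \<open>g y\<close>
  into those weighted by \<open>g x\<close>.\<close>

lemma green_formula:
  fixes f g :: "'a \<Rightarrow> real"
  shows "(\<Sum>(x, y)\<in>parcs G. (f x - f y) * (g x - g y))
           = 2 * (\<Sum>x\<in>pverts G. laplacian G f x * g x)"
proof -
  have "(\<Sum>(x, y)\<in>parcs G. (f x - f y) * (g x - g y))
      = (\<Sum>(x, y)\<in>parcs G. (f x - f y) * g x) + (\<Sum>(x, y)\<in>parcs G. (f y - f x) * g y)"
    unfolding sum.distrib[symmetric] by (rule sum.cong) (auto simp: algebra_simps)
  also have "(\<Sum>(x, y)\<in>parcs G. (f y - f x) * g y) = (\<Sum>(x, y)\<in>parcs G. (f x - f y) * g x)"
    by (rule sum_arcs_swap)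
  also have "(\<Sum>(x, y)\<in>parcs G. (f x - f y) * g x) = (\<Sum>x\<in>pverts G. laplacian G f x * g x)"
    unfolding sum_arcs laplacian_def by (simp add: sum_distrib_right)
  finally show ?thesis by simp
qed

lemma dirichlet_form_eq: "dirichlet_form G f = (\<Sum>x\<in>pverts G. laplacian G f x * f x)"
  using green_formula[of f f] by (simp add: dirichlet_form_def power2_eq_square)

lemma sum_laplacian: "(\<Sum>x\<in>pverts G. laplacian G f x) = 0"
  using green_formula[of f "\<lambda>_. 1"] by (simp add: case_prod_unfold)

lemma dirichlet_form_add:
  "dirichlet_form G (\<lambda>x. f x + g x) =
     dirichlet_form G f + dirichlet_form G g + 2 * (\<Sum>x\<in>pverts G. laplacian G f x * g x)"
proof -
  have "(\<Sum>(x, y)\<in>parcs G. (f x + g x - (f y + g y))\<^sup>2)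
      = (\<Sum>(x, y)\<in>parcs G. (f x - f y)\<^sup>2) + (\<Sum>(x, y)\<in>parcs G. (g x - g y)\<^sup>2)
        + 2 * (\<Sum>(x, y)\<in>parcs G. (f x - f y) * (g x - g y))"
    unfolding sum_distrib_left sum.distrib[symmetric]
    by (rule sum.cong) (auto simp: power2_eq_square algebra_simps)
  then show ?thesis
    unfolding green_formula dirichlet_form_def by (simp add: field_simps)
qed

text \<open>The Rayleigh quotient of an eigenfunction is its eigenvalue.\<close>

lemma eigenvalue_ge:
  assumes "poincare G \<kappa>" and sum0: "sum f (pverts G) = 0"
    and eig: "\<And>x. x \<in> pverts G \<Longrightarrow> laplacian G f x = \<nu> * f x"
    and nz: "x0 \<in> pverts G" "f x0 \<noteq> 0"
  shows "\<kappa> \<le> \<nu>"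
proof -
  let ?s = "\<Sum>x\<in>pverts G. (f x)\<^sup>2"
  have "\<kappa> * ?s \<le> dirichlet_form G f"
    by (rule poincareD[OF assms(1) sum0])
  also have "\<dots> = \<nu> * ?s"
    unfolding dirichlet_form_eq sum_distrib_left
    by (rule sum.cong) (auto simp: eig power2_eq_square)
  finally have "\<kappa> * ?s \<le> \<nu> * ?s" .
  moreover have "0 < ?s"
    by (rule sum_pos2[OF pair_finite_verts nz(1)]) (use nz in auto)
  ultimately show ?thesis by simp
qed

text \<open>The values of a Laplacian always sum to zero, so orthogonality to the constants is
  automatic for nonzero eigenvalues.\<close>

lemma eigenfunction_sum_zero:
  assumes "\<And>x. x \<in> pverts G \<Longrightarrow> laplacian G f x = \<nu> * f x" "\<nu> \<noteq> 0"
  shows "sum f (pverts G) = 0"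
proof -
  have "\<nu> * sum f (pverts G) = (\<Sum>x\<in>pverts G. laplacian G f x)"
    by (simp add: sum_distrib_left assms(1))
  with assms(2) show ?thesis by (simp add: sum_laplacian)
qed

lemma laplacian_matrix_mult_vec:
  assumes "distinct vs" "set vs = pverts G"
  shows "laplacian_matrix G vs *\<^sub>v vec (length vs) (\<lambda>i. f (vs ! i))
           = vec (length vs) (\<lambda>i. laplacian G f (vs ! i))"
proof (rule eq_vecI)
  fix i assume "i < dim_vec (vec (length vs) (\<lambda>i. laplacian G f (vs ! i)))"
  then have i: "i < length vs" by simp
  let ?a = "\<lambda>y. if (vs ! i, y) \<in> parcs G then 1 else 0 :: real"
  let ?d = "real (out_degree (with_proj G) (vs ! i))"
  have "(laplacian_matrix G vs *\<^sub>v vec (length vs) (\<lambda>i. f (vs ! i))) $ i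
      = (\<Sum>j<length vs. ((if i = j then ?d else 0) - ?a (vs ! j)) * f (vs ! j))"
    using i by (auto simp: laplacian_matrix_def degree_matrix_def adjacency_matrix_def mat_diag_def
        scalar_prod_def lessThan_atLeast0 intro!: sum.cong)
  also have "\<dots> = ?d * f (vs ! i) - (\<Sum>j<length vs. ?a (vs ! j) * f (vs ! j))"
    using i by (simp add: left_diff_distrib sum_subtractf if_distrib[of "\<lambda>x. x * _"] cong: if_cong)
  also have "(\<Sum>j<length vs. ?a (vs ! j) * f (vs ! j)) = (\<Sum>y\<in>pverts G. ?a y * f y)"
    by (rule sum.reindex_bij_betw) (use bij_betw_nth[OF assms(1) refl assms(2)[symmetric]] in simp)
  also have "\<dots> = (\<Sum>y | (vs ! i, y) \<in> parcs G. f y)"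
    by (rule sum.mono_neutral_cong_right) (auto simp: pair_finite_verts dest: in_arcsD2)
  finally show "(laplacian_matrix G vs *\<^sub>v vec (length vs) (\<lambda>i. f (vs ! i))) $ i
      = vec (length vs) (\<lambda>i. laplacian G f (vs ! i)) $ i"
    using i by (simp add: laplacian_eq_degree)
qed (simp_all add: laplacian_matrix_def degree_matrix_def adjacency_matrix_def mat_diag_def)

end

text \<open>In a distinct enumeration each vertex has a unique index, so a function can be read off
  a coordinate vector. This allows eigenvectors to be treated as eigenfunctions.\<close>

lemma vec_as_function:
  assumes "distinct vs" "v \<in> carrier_vec (length vs)"
  obtains f where "v = vec (length vs) (\<lambda>i. f (vs ! i))"
proof
  show "v = vec (length vs) (\<lambda>i. (\<lambda>x. v $ (SOME i. i < length vs \<and> vs ! i = x)) (vs ! i))"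
  proof (rule eq_vecI)
    fix i assume "i < dim_vec (vec (length vs) (\<lambda>i. (\<lambda>x. v $ (SOME i. i < length vs \<and> vs ! i = x)) (vs ! i)))"
    then have i: "i < length vs" by simp
    then have "(SOME j. j < length vs \<and> vs ! j = vs ! i) = i"
      by (intro some_equality) (use assms(1) in \<open>auto simp: nth_eq_iff_index_eq\<close>)
    with i show "v $ i = vec (length vs) (\<lambda>i. (\<lambda>x. v $ (SOME i. i < length vs \<and> vs ! i = x)) (vs ! i)) $ i"
      by simp
  qed (use assms(2) in simp)
qed

section \<open>The characteristic polynomial of the Laplacian\<close>

context pair_graph
begin

text \<open>Adding all rows of the characteristic matrix to the first one gives a row of constant entries
  \<open>X\<close>, since the columns of the Laplacian sum to zero. Pulling out this factor and replacing \<open>X\<close> by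
  \<open>0\<close> leaves the negated Laplacian with first row replaced by ones, which is regular iff the kernel of
  the Laplacian contains only constants.\<close>

lemma order_zero_char_poly_laplacian_matrix:
  assumes vs: "distinct vs" "set vs = pverts G" "vs \<noteq> []"
    and kernel: "\<And>f x. sum f (pverts G) = 0 \<Longrightarrow> (\<And>x. x \<in> pverts G \<Longrightarrow> laplacian G f x = 0)
                  \<Longrightarrow> x \<in> pverts G \<Longrightarrow> f x = 0"
  obtains q where "char_poly (laplacian_matrix G vs) = [:0, 1:] * q" "poly q 0 \<noteq> 0"
proof
  let ?n = "length vs" and ?L = "laplacian_matrix G vs"
  let ?C = "char_poly_matrix ?L"
  define E :: "real poly mat" where "E = mat ?n ?n (\<lambda>(i, j). if i = 0 \<or> i = j then 1 else 0)"
  define R where "R = mat ?n ?n (\<lambda>(i, j). if i = 0 then 1 else ?C $$ (i, j))"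
  define R0 where "R0 = mat ?n ?n (\<lambda>(i, j). if i = 0 then 1 else - ?L $$ (i, j))"
  have n: "0 < ?n" using vs(3) by simp
  have L: "?L \<in> carrier_mat ?n ?n" by (rule laplacian_matrix_carrier)
  have C: "?C \<in> carrier_mat ?n ?n" using L by simp
  have E: "E \<in> carrier_mat ?n ?n" and R: "R \<in> carrier_mat ?n ?n" and R0: "R0 \<in> carrier_mat ?n ?n"
    by (simp_all add: E_def R_def R0_def)
  have "det E = prod_list (diag_mat E)"
    by (rule det_upper_triangular[OF _ E]) (auto simp: upper_triangular_def E_def)
  also have "\<dots> = 1"
    unfolding prod_list_diag_prod by (rule prod.neutral) (auto simp: E_def)
  finally have det_E: "det E = 1" .
  \<comment> \<open>The column of \<open>vs ! j\<close> lists the values of the Laplacian of its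
    indicator function.\<close>
  have column: "(\<Sum>i<?n. ?L $$ (i, j)) = 0" if j: "j < ?n" for j
  proof -
    have "(\<Sum>i<?n. ?L $$ (i, j)) = (\<Sum>i<?n. laplacian G (\<lambda>x. if x = vs ! j then 1 else 0) (vs ! i))"
    proof (rule sum.cong)
      fix i assume "i \<in> {..<?n}"
      then have i: "i < ?n" by simp
      let ?f = "\<lambda>x. if x = vs ! j then 1 else 0 :: real"
      have "laplacian G ?f (vs ! i) = (?L *\<^sub>v vec ?n (\<lambda>i. ?f (vs ! i))) $ i"
        unfolding laplacian_matrix_mult_vec[OF vs(1,2), of ?f] using i by simp
      also have "\<dots> = (\<Sum>k<?n. ?L $$ (i, k) * ?f (vs ! k))"
        using i L by (simp add: scalar_prod_def lessThan_atLeast0)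
      also have "\<dots> = (\<Sum>k<?n. if k = j then ?L $$ (i, k) else 0)"
        by (rule sum.cong) (use j vs(1) in \<open>auto simp: nth_eq_iff_index_eq\<close>)
      also have "\<dots> = ?L $$ (i, j)" using j by simp
      finally show "?L $$ (i, j) = laplacian G ?f (vs ! i)" ..
    qed simp
    also have "\<dots> = (\<Sum>x\<in>pverts G. laplacian G (\<lambda>x. if x = vs ! j then 1 else 0) x)"
      by (rule sum.reindex_bij_betw) (use bij_betw_nth[OF vs(1) refl vs(2)[symmetric]] in simp)
    finally show ?thesis by (simp add: sum_laplacian)
  qed
  have "E * ?C = multrow 0 [:0, 1:] R"
  proof (rule eq_matI)
    fix i j assume "i < dim_row (multrow 0 [:0, 1:] R)" "j < dim_col (multrow 0 [:0, 1:] R)"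
    then have ij: "i < ?n" "j < ?n" using R by auto
    have EC: "(E * ?C) $$ (i, j) = (\<Sum>k<?n. E $$ (i, k) * ?C $$ (k, j))"
      using ij E C by (simp add: scalar_prod_def lessThan_atLeast0)
    show "(E * ?C) $$ (i, j) = multrow 0 [:0, 1:] R $$ (i, j)"
    proof (cases "i = 0")
      case True
      have "(E * ?C) $$ (i, j) = (\<Sum>k<?n. (if k = j then [:0, 1:] else 0) + [:- ?L $$ (k, j):])"
        unfolding EC by (rule sum.cong) (use True ij L in \<open>auto simp: E_def char_poly_matrix_def\<close>)
      also have "\<dots> = [:0, 1:] + [:- (\<Sum>k<?n. ?L $$ (k, j)):]"
        using ij by (intro poly_eqI)
          (simp add: coeff_sum sum.distrib sum_negf coeff_pCons split: nat.split)
      finally show ?thesis using True ij by (simp add: column R_def)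
    next
      case False
      have "(E * ?C) $$ (i, j) = (\<Sum>k<?n. if k = i then ?C $$ (k, j) else 0)"
        unfolding EC by (rule sum.cong) (use False ij in \<open>auto simp: E_def\<close>)
      with False ij show ?thesis by (simp add: R_def)
    qed
  qed (use E C R in auto)
  then have "det (E * ?C) = [:0, 1:] * det R"
    using det_multrow[OF n R] by simp
  then show "char_poly ?L = [:0, 1:] * det R"
    by (simp add: char_poly_def det_mult[OF E C] det_E)
  have "poly (det R) 0 = det R0"
    by (rule poly_det_cong[OF R0 R]) (use L in \<open>auto simp: R_def R0_def char_poly_matrix_def\<close>)
  moreover have "det R0 \<noteq> 0"
  proof
    assume "det R0 = 0"
    then obtain v where v: "v \<in> carrier_vec ?n" "v \<noteq> 0\<^sub>v ?n" "R0 *\<^sub>v v = 0\<^sub>v ?n"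
      using det_0_iff_vec_prod_zero[OF R0] by blast
    obtain f where f: "v = vec ?n (\<lambda>i. f (vs ! i))"
      using vec_as_function[OF vs(1) v(1)] .
    have row: "(R0 *\<^sub>v v) $ i = (\<Sum>k<?n. R0 $$ (i, k) * f (vs ! k))" if "i < ?n" for i
      using that R0 by (simp add: f scalar_prod_def lessThan_atLeast0)
    have bij: "(\<Sum>i<?n. g (vs ! i)) = sum g (pverts G)" for g :: "'a \<Rightarrow> real"
      by (rule sum.reindex_bij_betw) (use bij_betw_nth[OF vs(1) refl vs(2)[symmetric]] in simp)
    have "(\<Sum>k<?n. f (vs ! k)) = (\<Sum>k<?n. R0 $$ (0, k) * f (vs ! k))"
      by (rule sum.cong) (use n in \<open>auto simp: R0_def\<close>)
    then have sum0: "sum f (pverts G) = 0"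
      using row[OF n] n v(3) bij[of f] by simp
    \<comment> \<open>The first row of \<open>R0\<close> says that \<open>f\<close> has zero sum;
      the others, that its Laplacian vanishes away from the first vertex.\<close>
    have lap: "laplacian G f (vs ! i) = 0" if i: "i < ?n" "i \<noteq> 0" for i
    proof -
      have "laplacian G f (vs ! i) = (?L *\<^sub>v v) $ i"
        unfolding f laplacian_matrix_mult_vec[OF vs(1,2), of f] using i by simp
      also have "\<dots> = - (\<Sum>k<?n. R0 $$ (i, k) * f (vs ! k))"
        unfolding sum_negf[symmetric] using i L
        by (auto simp: f R0_def scalar_prod_def lessThan_atLeast0 intro!: sum.cong)
      finally show ?thesis using row[OF i(1)] v(3) i(1) by simp
    qed
    \<comment> \<open>The information lost with the replaced row is recovered: the values of the
      Laplacian sum to zero, so the one remaining value vanishes as well.\<close>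
    have "(\<Sum>i<?n. laplacian G f (vs ! i)) = laplacian G f (vs ! 0)"
      by (rule sum.remove[of _ 0, THEN trans]) (use n lap in auto)
    then have "laplacian G f (vs ! 0) = 0"
      using bij[of "laplacian G f"] sum_laplacian by simp
    with lap have "laplacian G f (vs ! i) = 0" if "i < ?n" for i
      using that by (cases "i = 0") auto
    then have "laplacian G f x = 0" if "x \<in> pverts G" for x
      using that vs(2) by (metis in_set_conv_nth)
    from kernel[OF sum0 this] have "f x = 0" if "x \<in> pverts G" for x
      using that by blast
    then have "v = 0\<^sub>v ?n"
      unfolding f using vs(2) nth_mem[of _ vs] by (intro eq_vecI) auto
    with v(2) show False by contradiction
  qed
  ultimately show "poly (det R) 0 \<noteq> 0" by simp
qed

text \<open>The Poincare inequality with \<open>0 < \<kappa>\<close> makes 0 a simple root and puts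
  all other roots at or above \<kappa>, and the given eigenfunction shows that \<kappa> is attained.
  So the sorted spectrum starts with 0, \<kappa>.\<close>

lemma algebraic_connectivity_eqI:
  assumes "0 < \<kappa>" and poincare: "poincare G \<kappa>"
    and eig: "\<And>x. x \<in> pverts G \<Longrightarrow> laplacian G f x = \<kappa> * f x"
    and nz: "x0 \<in> pverts G" "f x0 \<noteq> 0"
  shows "algebraic_connectivity G = \<kappa>"
proof -
  define vs where "vs = (SOME vs. distinct vs \<and> set vs = pverts G)"
  have vs: "distinct vs" "set vs = pverts G"
    using someI_ex[of "\<lambda>vs. distinct vs \<and> set vs = pverts G"]
      finite_distinct_list[OF pair_finite_verts] by (auto simp: vs_def)
  then have "vs \<noteq> []" using nz by auto
  define p where "p = char_poly (laplacian_matrix G vs)"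
  have L: "laplacian_matrix G vs \<in> carrier_mat (length vs) (length vs)"
    by (rule laplacian_matrix_carrier)
  have root: "\<kappa> \<le> \<nu>" if g: "sum g (pverts G) = 0" "x \<in> pverts G" "g x \<noteq> 0"
      "\<And>x. x \<in> pverts G \<Longrightarrow> laplacian G g x = \<nu> * g x" for g x \<nu>
    by (rule eigenvalue_ge[OF poincare g(1) g(4) g(2,3)])
  obtain q where q: "p = [:0, 1:] * q" "poly q 0 \<noteq> 0"
    unfolding p_def
  proof (rule order_zero_char_poly_laplacian_matrix[OF vs \<open>vs \<noteq> []\<close>])
    \<comment> \<open>A zero-sum kernel function that is nonzero at some vertex would be an
      eigenfunction for 0 and force \<open>\<kappa> \<le> 0\<close>.\<close>
    fix f x assume "sum f (pverts G) = 0" "\<And>x. x \<in> pverts G \<Longrightarrow> laplacian G f x = 0" "x \<in> pverts G"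
    then show "f x = 0" using root[of f x 0] \<open>0 < \<kappa>\<close> by fastforce
  qed
  have eigvec: "poly p \<nu> = 0 \<longleftrightarrow> (\<exists>g. (\<exists>x\<in>pverts G. g x \<noteq> 0) \<and>
      (\<forall>x\<in>pverts G. laplacian G g x = \<nu> * g x))" for \<nu>
  proof -
    have "poly p \<nu> = 0 \<longleftrightarrow> (\<exists>v. v \<in> carrier_vec (length vs) \<and> v \<noteq> 0\<^sub>v (length vs)
        \<and> laplacian_matrix G vs *\<^sub>v v = \<nu> \<cdot>\<^sub>v v)"
      unfolding p_def eigenvalue_root_char_poly[OF L, symmetric] eigenvalue_def eigenvector_def
      using L by simp
    also have "\<dots> \<longleftrightarrow> (\<exists>g. vec (length vs) (\<lambda>i. g (vs ! i)) \<noteq> 0\<^sub>v (length vs)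
        \<and> vec (length vs) (\<lambda>i. laplacian G g (vs ! i)) = \<nu> \<cdot>\<^sub>v vec (length vs) (\<lambda>i. g (vs ! i)))"
    proof safe
      fix v assume v: "v \<in> carrier_vec (length vs)" "v \<noteq> 0\<^sub>v (length vs)"
        "laplacian_matrix G vs *\<^sub>v v = \<nu> \<cdot>\<^sub>v v"
      obtain g where g: "v = vec (length vs) (\<lambda>i. g (vs ! i))"
        using vec_as_function[OF vs(1) v(1)] .
      show "\<exists>g. vec (length vs) (\<lambda>i. g (vs ! i)) \<noteq> 0\<^sub>v (length vs)
        \<and> vec (length vs) (\<lambda>i. laplacian G g (vs ! i)) = \<nu> \<cdot>\<^sub>v vec (length vs) (\<lambda>i. g (vs ! i))"
        using v(2,3) unfolding g laplacian_matrix_mult_vec[OF vs, of g] by blast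
    next
      fix g assume "vec (length vs) (\<lambda>i. g (vs ! i)) \<noteq> 0\<^sub>v (length vs)"
        "vec (length vs) (\<lambda>i. laplacian G g (vs ! i)) = \<nu> \<cdot>\<^sub>v vec (length vs) (\<lambda>i. g (vs ! i))"
      then show "\<exists>v. v \<in> carrier_vec (length vs) \<and> v \<noteq> 0\<^sub>v (length vs)
        \<and> laplacian_matrix G vs *\<^sub>v v = \<nu> \<cdot>\<^sub>v v"
        unfolding laplacian_matrix_mult_vec[OF vs, of g, symmetric]
        by (intro exI[of _ "vec (length vs) (\<lambda>i. g (vs ! i))"] conjI) (assumption | simp)+
    qed
    also have "\<dots> \<longleftrightarrow> (\<exists>g. (\<exists>x\<in>pverts G. g x \<noteq> 0) \<and> (\<forall>x\<in>pverts G. laplacian G g x = \<nu> * g x))"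
      unfolding vs(2)[symmetric] by (auto simp: vec_eq_iff all_set_conv_all_nth Bex_def in_set_conv_nth)
    finally show ?thesis .
  qed
  have "poly p \<kappa> = 0"
    unfolding eigvec using eig nz by blast
  then have "poly q \<kappa> = 0" using q(1) \<open>0 < \<kappa>\<close> by simp
  have ge: "\<kappa> \<le> \<nu>" if "poly q \<nu> = 0" for \<nu>
  proof -
    have "\<nu> \<noteq> 0" using that q(2) by auto
    have "poly p \<nu> = 0" using that q(1) by simp
    then obtain g x where g: "x \<in> pverts G" "g x \<noteq> 0"
      "\<And>x. x \<in> pverts G \<Longrightarrow> laplacian G g x = \<nu> * g x"
      unfolding eigvec by blast
    show ?thesis
      by (rule root[OF eigenfunction_sum_zero[OF g(3) \<open>\<nu> \<noteq> 0\<close>] g])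
  qed
  \<comment> \<open>The root 0 is split off exactly once, so entry 1 of the spectrum is the least
    root of \<open>q\<close>; the multiplicity of \<kappa> need not be known.\<close>
  have "q \<noteq> 0" using q(2) by auto
  then have "proots p = add_mset 0 (proots q)"
    unfolding q(1) by (subst proots_mult) (use proots_linear_factor[of "0 :: real"] in simp_all)
  moreover have "sorted_list_of_multiset (add_mset 0 (proots q)) = 0 # sorted_list_of_multiset (proots q)"
  proof -
    have "\<forall>x\<in>set (sorted_list_of_multiset (proots q)). 0 \<le> x"
      using \<open>q \<noteq> 0\<close> \<open>0 < \<kappa>\<close> ge by fastforce
    then show ?thesis
      by (cases "sorted_list_of_multiset (proots q)") simp_all
  qed
  moreover have "sorted_list_of_multiset (proots q) ! 0 = \<kappa>"
  proof -
    let ?xs = "sorted_list_of_multiset (proots q)"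
    have set: "set ?xs = {\<nu>. poly q \<nu> = 0}" using \<open>q \<noteq> 0\<close> by simp
    then have \<kappa>: "\<kappa> \<in> set ?xs" using \<open>poly q \<kappa> = 0\<close> by simp
    have "?xs ! 0 \<in> set ?xs" using \<kappa> by (intro nth_mem) (rule length_pos_if_in_set)
    then have "\<kappa> \<le> ?xs ! 0" using set ge by simp
    moreover obtain i where "i < length ?xs" "?xs ! i = \<kappa>"
      using \<kappa> unfolding in_set_conv_nth by blast
    then have "?xs ! 0 \<le> \<kappa>"
      using sorted_nth_mono[OF sorted_sorted_list_of_multiset le0] by metis
    ultimately show ?thesis by (rule antisym[rotated])
  qed
  ultimately show ?thesis
    unfolding algebraic_connectivity_def laplacian_spectrum_def Let_def vs_def[symmetric] p_def[symmetric]
    by simp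
qed

end

subsection \<open>Token graphs\<close>

lemma pverts_token_graph: "pverts (token_graph k G) = {A. A \<subseteq> pverts G \<and> card A = k}"
  by (simp add: token_graph_def)

lemma token_graph_arcD:
  assumes "(A, B) \<in> parcs (token_graph k G)"
  obtains a b where "a \<in> A" "a \<notin> B" "b \<in> B" "b \<notin> A" "(a, b) \<in> parcs G"
    "sym_diff A B = {a, b}" "A \<subseteq> pverts G" "B \<subseteq> pverts G" "card A = k" "card B = k"
proof -
  from assms obtain a b where ab: "a \<in> A" "b \<in> B" "sym_diff A B = {a, b}" "(a, b) \<in> parcs G"
    "A \<subseteq> pverts G" "B \<subseteq> pverts G" "card A = k" "card B = k"
    by (auto simp: token_graph_def)
  moreover from ab have "a \<notin> B" "b \<notin> A" by blast+
  ultimately show thesis by (intro that)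
qed

section \<open>Lifts of vertex functions and their adjoint\<close>

definition token_sum :: "nat \<Rightarrow> 'a set \<Rightarrow> ('a set \<Rightarrow> real) \<Rightarrow> 'a \<Rightarrow> real" where
  "token_sum k V f a = (\<Sum>A | A \<subseteq> V \<and> card A = k \<and> a \<in> A. f A)"

text \<open>Double counting of the pairs \<open>a \<in> A\<close>. It exhibits
  \<open>token_sum\<close> as the adjoint of the lift \<open>sum\<close>, so functions whose token
  sums all vanish are orthogonal to every lift.\<close>

lemma sum_lift_mult:
  assumes "finite V"
  shows "(\<Sum>A | A \<subseteq> V \<and> card A = k. sum u A * f A) = (\<Sum>a\<in>V. u a * token_sum k V f a)"
proof -
  let ?T = "{A. A \<subseteq> V \<and> card A = k}"
  have T: "finite ?T" using assms by auto
  have "(\<Sum>A\<in>?T. sum u A * f A) = (\<Sum>A\<in>?T. \<Sum>a | a \<in> V \<and> a \<in> A. u a * f A)"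
    by (intro sum.cong refl) (auto simp: sum_distrib_right intro!: sum.cong)
  also have "\<dots> = (\<Sum>a\<in>V. \<Sum>A | A \<in> ?T \<and> a \<in> A. u a * f A)"
    by (rule sum.swap_restrict[OF T assms])
  also have "\<dots> = (\<Sum>a\<in>V. u a * token_sum k V f a)"
    by (simp add: token_sum_def sum_distrib_left conj_assoc)
  finally show ?thesis .
qed

text \<open>Adjointness applied to the constant 1, whose lift is the constant
  \<open>k\<close>.\<close>

lemma sum_token_sum:
  assumes "finite V"
  shows "(\<Sum>a\<in>V. token_sum k V f a) = real k * (\<Sum>A | A \<subseteq> V \<and> card A = k. f A)"
  using sum_lift_mult[OF assms, of "\<lambda>_. 1" f k] by (simp add: sum_distrib_left)

text \<open>Removing \<open>a\<close> leaves an arbitrary \<open>(k - 1)\<close>-subset of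
  \<open>V - {a, y}\<close>.\<close>

lemma card_tokens_separating:
  assumes "finite V" "a \<in> V" "y \<in> V" "y \<noteq> a" "1 \<le> k"
  shows "card {A. A \<subseteq> V \<and> card A = k \<and> a \<in> A \<and> y \<notin> A} = (card V - 2) choose (k - 1)"
proof -
  have "bij_betw (insert a) {B. B \<subseteq> V - {a, y} \<and> card B = k - 1}
      {A. A \<subseteq> V \<and> card A = k \<and> a \<in> A \<and> y \<notin> A}"
  proof (rule bij_betwI[where g = "\<lambda>A. A - {a}"])
    show "insert a \<in> {B. B \<subseteq> V - {a, y} \<and> card B = k - 1} \<rightarrow> {A. A \<subseteq> V \<and> card A = k \<and> a \<in> A \<and> y \<notin> A}"
    proof
      fix B assume B: "B \<in> {B. B \<subseteq> V - {a, y} \<and> card B = k - 1}"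
      then have "finite B" using assms(1) by (auto intro: finite_subset)
      moreover have "a \<notin> B" using B by auto
      ultimately show "insert a B \<in> {A. A \<subseteq> V \<and> card A = k \<and> a \<in> A \<and> y \<notin> A}"
        using B assms by auto
    qed
  qed (use assms in auto)
  then have "card {A. A \<subseteq> V \<and> card A = k \<and> a \<in> A \<and> y \<notin> A}
      = card {B. B \<subseteq> V - {a, y} \<and> card B = k - 1}"
    by (rule bij_betw_same_card[symmetric])
  also have "\<dots> = card (V - {a, y}) choose (k - 1)"
    by (rule n_subsets) (use assms in simp)
  also have "card (V - {a, y}) = card V - 2"
    using assms by (simp add: card_Diff_subset)
  finally show ?thesis .
qed

text \<open>On zero-sum functions the adjoint after the lift is a scalar. As \<open>u\<close> sums
  to zero, its sum over \<open>A\<close> is minus its sum over the complement; every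
  \<open>y \<noteq> a\<close> lies in the complement of equally many tokens containing
  \<open>a\<close>, and these \<open>u y\<close> add up to \<open>- u a\<close>.\<close>

lemma token_sum_lift:
  fixes u :: "'a \<Rightarrow> real"
  assumes V: "finite V" "a \<in> V" and k: "1 \<le> k" and sum0: "sum u V = 0"
  shows "token_sum k V (sum u) a = real ((card V - 2) choose (k - 1)) * u a"
proof -
  let ?d = "real ((card V - 2) choose (k - 1))"
  let ?T = "{A. A \<subseteq> V \<and> card A = k \<and> a \<in> A}"
  have T: "finite ?T" using V(1) by auto
  have "token_sum k V (sum u) a = (\<Sum>A\<in>?T. \<Sum>y | y \<in> V \<and> y \<in> A. u y)"
    unfolding token_sum_def by (intro sum.cong refl) auto
  also have "\<dots> = (\<Sum>A\<in>?T. - (\<Sum>y | y \<in> V \<and> y \<notin> A. u y))"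
  proof (intro sum.cong refl)
    fix A
    have "sum u V = (\<Sum>y | y \<in> V \<and> y \<in> A. u y) + (\<Sum>y | y \<in> V \<and> y \<notin> A. u y)"
      using V(1) by (subst sum.union_disjoint[symmetric]) (auto intro!: sum.cong)
    then show "(\<Sum>y | y \<in> V \<and> y \<in> A. u y) = - (\<Sum>y | y \<in> V \<and> y \<notin> A. u y)"
      using sum0 by simp
  qed
  also have "\<dots> = - (\<Sum>y\<in>V. \<Sum>A | A \<in> ?T \<and> y \<notin> A. u y)"
    unfolding sum_negf by (subst sum.swap_restrict[OF T V(1)]) simp
  also have "\<dots> = - (\<Sum>y\<in>V - {a}. ?d * u y)"
  proof -
    have "(\<Sum>y\<in>V. \<Sum>A | A \<in> ?T \<and> y \<notin> A. u y) = (\<Sum>y\<in>V - {a}. \<Sum>A | A \<in> ?T \<and> y \<notin> A. u y)"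
      using V(1) by (intro sum.mono_neutral_right) auto
    also have "\<dots> = (\<Sum>y\<in>V - {a}. ?d * u y)"
      using card_tokens_separating[OF V _ _ k] by (intro sum.cong refl) (simp add: conj_assoc)
    finally show ?thesis by simp
  qed
  also have "\<dots> = ?d * u a"
    using sum0 V by (simp add: sum_distrib_left[symmetric] sum_diff1)
  finally show ?thesis .
qed

context pair_graph
begin

lemma pair_graph_token: "pair_graph (token_graph k G)"
  by (rule pair_graph_token_graph) unfold_locales

text \<open>The lift intertwines the two Laplacians: moving a token from \<open>a\<close> to
  \<open>b\<close> lowers the lift by \<open>u a - u b\<close>. The arcs inside \<open>A\<close>,
  absent from the left side, cancel in opposite pairs on the right.\<close>

lemma laplacian_token_graph_lift:
  assumes A: "A \<subseteq> pverts G" "card A = k"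
  shows "laplacian (token_graph k G) (sum u) A = (\<Sum>a\<in>A. laplacian G u a)"
proof -
  let ?move = "\<lambda>(a, b). insert b (A - {a})"
  let ?out = "{(a, b). (a, b) \<in> parcs G \<and> a \<in> A \<and> b \<notin> A}"
  let ?inn = "{(a, b). (a, b) \<in> parcs G \<and> a \<in> A \<and> b \<in> A}"
  have finA: "finite A" using A(1) pair_finite_verts by (rule finite_subset)
  have fin: "finite ?out" "finite ?inn"
    by (rule finite_subset[OF _ pair_finite_arcs], blast)+
  have "bij_betw ?move ?out {B. (A, B) \<in> parcs (token_graph k G)}"
    unfolding bij_betw_def
  proof
    show "inj_on ?move ?out"
    \<comment> \<open>The move is read back from the two one-element differences of the vertex
      sets.\<close>
    proof (rule inj_on_inverseI[where g = "\<lambda>B. (the_elem (A - B), the_elem (B - A))"])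
      fix p assume "p \<in> ?out"
      then obtain a b where p: "p = (a, b)" "a \<in> A" "b \<notin> A" by blast
      then have "A - ?move p = {a}" "?move p - A = {b}" by auto
      then show "(the_elem (A - ?move p), the_elem (?move p - A)) = p" by (simp only: the_elem_eq p)
    qed
    show "?move ` ?out = {B. (A, B) \<in> parcs (token_graph k G)}"
    proof (intro equalityI subsetI)
      fix B assume "B \<in> ?move ` ?out"
      then obtain a b where ab: "(a, b) \<in> parcs G" "a \<in> A" "b \<notin> A" "B = insert b (A - {a})"
        by auto
      have "0 < k" using ab finA A(2) by (auto simp: card_gt_0_iff)
      then have "card B = k" using ab finA A(2) by simp
      moreover have "sym_diff A B = {a, b}" using ab by auto
      ultimately show "B \<in> {B. (A, B) \<in> parcs (token_graph k G)}"
        using ab A by (auto simp: token_graph_def dest: in_arcsD2)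
    next
      fix B assume "B \<in> {B. (A, B) \<in> parcs (token_graph k G)}"
      then have "(A, B) \<in> parcs (token_graph k G)" by simp
      then obtain a b where ab: "a \<in> A" "a \<notin> B" "b \<in> B" "b \<notin> A" "(a, b) \<in> parcs G" "sym_diff A B = {a, b}"
        by (rule token_graph_arcD)
      then have "B = insert b (A - {a})" by blast
      with ab show "B \<in> ?move ` ?out" by (auto intro!: image_eqI[of _ _ "(a, b)"])
    qed
  qed
  then have "laplacian (token_graph k G) (sum u) A = (\<Sum>p\<in>?out. sum u A - sum u (?move p))"
    unfolding laplacian_def by (rule sum.reindex_bij_betw[symmetric])
  also have "\<dots> = (\<Sum>(a, b)\<in>?out. u a - u b)"
    using finA by (intro sum.cong refl) (auto simp: sum_diff1)
  also have "\<dots> = (\<Sum>(a, b)\<in>?out. u a - u b) + (\<Sum>(a, b)\<in>?inn. u a - u b)"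
  proof -
    have "(\<Sum>(a, b)\<in>?inn. u a - u b) = (\<Sum>(a, b)\<in>?inn. u b - u a)"
      by (rule sum.reindex_bij_witness[of _ prod.swap prod.swap]) (auto intro: arc_sym)
    also have "\<dots> = - (\<Sum>(a, b)\<in>?inn. u a - u b)"
      by (simp add: sum_negf[symmetric] case_prod_unfold)
    finally show ?thesis by simp
  qed
  also have "\<dots> = (\<Sum>(a, b)\<in>?out \<union> ?inn. u a - u b)"
    by (rule sum.union_disjoint[symmetric]) (use fin in auto)
  also have "?out \<union> ?inn = (SIGMA a:A. {b. (a, b) \<in> parcs G})"
    by auto
  also have "(\<Sum>(a, b)\<in>(SIGMA a:A. {b. (a, b) \<in> parcs G}). u a - u b) = (\<Sum>a\<in>A. laplacian G u a)"
    unfolding laplacian_def by (rule sum.Sigma[symmetric]) (auto simp: finA finite_neighbours)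
  finally show ?thesis .
qed

text \<open>Every \<open>f\<close> with zero sum splits into the lift \<open>A \<mapsto> (\<Sum>a\<in>A. u a)\<close> of a function \<open>u\<close> on the
  vertices and a remainder that is orthogonal to all lifts. The splitting is orthogonal for the
  Dirichlet form as well, since the Laplacian maps lifts to lifts.\<close>

lemma poincare_token_graphI:
  assumes poincare: "poincare G \<kappa>" and k: "1 \<le> k" "k < card (pverts G)"
    and kernel: "\<And>w. (\<And>a. a \<in> pverts G \<Longrightarrow> token_sum k (pverts G) w a = 0)
      \<Longrightarrow> \<kappa> * (\<Sum>A | A \<subseteq> pverts G \<and> card A = k. (w A)\<^sup>2) \<le> dirichlet_form (token_graph k G) w"
  shows "poincare (token_graph k G) \<kappa>"
proof (rule poincareI)
  let ?V = "pverts G" and ?H = "token_graph k G"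
  let ?T = "{A. A \<subseteq> ?V \<and> card A = k}"
  interpret H: pair_graph ?H by (rule pair_graph_token)
  fix f :: "'a set \<Rightarrow> real" assume "sum f (pverts ?H) = 0"
  then have sum_f: "sum f ?T = 0" by (simp add: pverts_token_graph)
  \<comment> \<open>This is the scalar of \<open>token_sum_lift\<close>, positive because
    \<open>1 \<le> k\<close> and \<open>k\<close> is below the number of vertices. Dividing by it
    makes the lift of \<open>u\<close> the orthogonal projection of \<open>f\<close> onto the lifts
    of zero-sum functions.\<close>
  define d where "d = real ((card ?V - 2) choose (k - 1))"
  have "0 < d" using k by (simp add: d_def zero_less_binomial_iff)
  define u where "u = (\<lambda>a. token_sum k ?V f a / d)"
  define w where "w = (\<lambda>A. f A - sum u A)"
  have sum_u: "sum u ?V = 0"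
    by (simp add: u_def sum_divide_distrib[symmetric] sum_token_sum[OF pair_finite_verts] sum_f)
  have lift: "token_sum k ?V (sum u) a = d * u a" if "a \<in> ?V" for a
    unfolding d_def by (rule token_sum_lift[OF pair_finite_verts that k(1) sum_u])
  have w0: "token_sum k ?V w a = 0" if "a \<in> ?V" for a
  proof -
    have "token_sum k ?V w a = token_sum k ?V f a - token_sum k ?V (sum u) a"
      by (simp add: token_sum_def w_def sum_subtractf)
    also have "\<dots> = 0" using \<open>0 < d\<close> that by (simp add: lift) (simp add: u_def)
    finally show ?thesis .
  qed
  have f_eq: "f = (\<lambda>A. sum u A + w A)" by (simp add: w_def)
  \<comment> \<open>Intertwining followed by adjointness. For \<open>g = w\<close> the right side
    vanishes, which removes the mixed term of the Dirichlet form.\<close>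
  have lap: "(\<Sum>A\<in>?T. laplacian ?H (sum u) A * g A) = (\<Sum>a\<in>?V. laplacian G u a * token_sum k ?V g a)" for g
    unfolding sum_lift_mult[OF pair_finite_verts, symmetric]
    by (intro sum.cong refl) (simp add: laplacian_token_graph_lift)
  have "dirichlet_form ?H (sum u) = d * dirichlet_form G u"
    unfolding H.dirichlet_form_eq dirichlet_form_eq pverts_token_graph lap
    by (simp add: lift sum_distrib_left ac_simps)
  moreover have "dirichlet_form ?H f = dirichlet_form ?H (sum u) + dirichlet_form ?H w"
    by (subst f_eq) (simp add: H.dirichlet_form_add pverts_token_graph lap w0)
  ultimately have D: "dirichlet_form ?H f = d * dirichlet_form G u + dirichlet_form ?H w"
    by simp
  have "(\<Sum>A\<in>?T. (f A)\<^sup>2) = (\<Sum>A\<in>?T. sum u A * sum u A) + 2 * (\<Sum>A\<in>?T. sum u A * w A) + (\<Sum>A\<in>?T. (w A)\<^sup>2)"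
    unfolding sum_distrib_left[of 2] sum.distrib[symmetric]
    by (rule sum.cong) (auto simp: w_def power2_eq_square algebra_simps)
  also have "\<dots> = d * (\<Sum>a\<in>?V. (u a)\<^sup>2) + (\<Sum>A\<in>?T. (w A)\<^sup>2)"
    unfolding sum_lift_mult[OF pair_finite_verts]
    by (simp add: lift w0 sum_distrib_left power2_eq_square ac_simps)
  finally have "\<kappa> * (\<Sum>A\<in>?T. (f A)\<^sup>2) = d * (\<kappa> * (\<Sum>a\<in>?V. (u a)\<^sup>2)) + \<kappa> * (\<Sum>A\<in>?T. (w A)\<^sup>2)"
    by (simp add: algebra_simps)
  also have "\<dots> \<le> d * dirichlet_form G u + dirichlet_form ?H w"
    using kernel[OF w0] poincareD[OF poincare sum_u] \<open>0 < d\<close> by (intro add_mono mult_left_mono) auto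
  finally show "\<kappa> * (\<Sum>A\<in>pverts ?H. (f A)\<^sup>2) \<le> dirichlet_form ?H f"
    by (simp add: D pverts_token_graph)
qed

end

section \<open>Deleting a vertex of the underlying graph\<close>

definition delete_vertex :: "'a pair_pre_digraph \<Rightarrow> 'a \<Rightarrow> 'a pair_pre_digraph" where
  "delete_vertex G c =
     \<lparr> pverts = pverts G - {c}, parcs = {(x, y). (x, y) \<in> parcs G \<and> x \<noteq> c \<and> y \<noteq> c} \<rparr>"

lemma parcs_token_graph_delete_vertex:
  "parcs (token_graph k (delete_vertex G c)) = {(A, B) \<in> parcs (token_graph k G). c \<notin> A \<and> c \<notin> B}"
  by (auto simp: token_graph_def delete_vertex_def)

lemma bij_betw_insert_token:
  assumes "finite V" "c \<in> V"
  shows "bij_betw (insert c) {A. A \<subseteq> V - {c} \<and> card A = j} {A. A \<subseteq> V \<and> card A = Suc j \<and> c \<in> A}"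
proof (rule bij_betwI[where g = "\<lambda>A. A - {c}"])
  show "insert c \<in> {A. A \<subseteq> V - {c} \<and> card A = j} \<rightarrow> {A. A \<subseteq> V \<and> card A = Suc j \<and> c \<in> A}"
  proof
    fix A assume A: "A \<in> {A. A \<subseteq> V - {c} \<and> card A = j}"
    then have "finite A" "c \<notin> A" using assms(1) by (auto intro: finite_subset)
    with A assms show "insert c A \<in> {A. A \<subseteq> V \<and> card A = Suc j \<and> c \<in> A}" by auto
  qed
qed auto

context pair_graph
begin

text \<open>A token arc that leaves \<open>c\<close> untouched has \<open>c\<close> in both ends or
  in neither. In the second case it is an arc over \<open>G - c\<close> with \<open>Suc j\<close>
  tokens; in the first, removing the fixed token at \<open>c\<close> gives one with \<open>j\<close>
  tokens.\<close>

lemma dirichlet_form_token_delete_vertex: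
  assumes c: "c \<in> pverts G"
  shows "dirichlet_form (token_graph (Suc j) (delete_vertex G c)) w
       + dirichlet_form (token_graph j (delete_vertex G c)) (\<lambda>A. w (insert c A))
       = (\<Sum>(A, B) | (A, B) \<in> parcs (token_graph (Suc j) G) \<and> (c \<in> A \<longleftrightarrow> c \<in> B). (w A - w B)\<^sup>2) / 2"
proof -
  interpret H: pair_graph "token_graph (Suc j) G" by (rule pair_graph_token)
  let ?E = "parcs (token_graph (Suc j) G)"
  let ?in = "{(A, B) \<in> ?E. c \<in> A \<and> c \<in> B}" and ?out = "{(A, B) \<in> ?E. c \<notin> A \<and> c \<notin> B}"
  let ?del = "parcs (token_graph j (delete_vertex G c))"
  have fin: "finite ?in" "finite ?out"
    by (rule finite_subset[OF _ H.pair_finite_arcs], blast)+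
  have "(\<Sum>(A, B)\<in>?del. (w (insert c A) - w (insert c B))\<^sup>2) = (\<Sum>(A, B)\<in>?in. (w A - w B)\<^sup>2)"
  proof (rule sum.reindex_bij_witness[of _ "\<lambda>(A, B). (A - {c}, B - {c})" "\<lambda>(A, B). (insert c A, insert c B)"])
    fix p assume p: "p \<in> ?del"
    obtain A B where [simp]: "p = (A, B)" by (cases p)
    from p obtain a b where ab: "a \<in> A" "a \<notin> B" "b \<in> B" "b \<notin> A" "(a, b) \<in> parcs (delete_vertex G c)"
      "sym_diff A B = {a, b}" "A \<subseteq> pverts (delete_vertex G c)" "B \<subseteq> pverts (delete_vertex G c)"
      "card A = j" "card B = j"
      unfolding \<open>p = (A, B)\<close> by (rule token_graph_arcD)
    then have cAB: "c \<notin> A" "c \<notin> B" "(a, b) \<in> parcs G" "A \<subseteq> pverts G" "B \<subseteq> pverts G"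
      by (auto simp: delete_vertex_def)
    then have "finite A" "finite B" using pair_finite_verts by (auto intro: finite_subset)
    then have "card (insert c A) = Suc j" "card (insert c B) = Suc j" using cAB ab by auto
    moreover have "sym_diff (insert c A) (insert c B) = {a, b}" using ab cAB by auto
    ultimately show "(\<lambda>(A, B). (insert c A, insert c B)) p \<in> ?in"
      using ab cAB c by (auto simp: token_graph_def)
    show "(\<lambda>(A, B). (A - {c}, B - {c})) ((\<lambda>(A, B). (insert c A, insert c B)) p) = p"
      using cAB by auto
  next
    fix p assume p: "p \<in> ?in"
    obtain A B where [simp]: "p = (A, B)" by (cases p)
    from p have cAB: "(A, B) \<in> ?E" "c \<in> A" "c \<in> B" by auto
    from cAB(1) obtain a b where ab: "a \<in> A" "a \<notin> B" "b \<in> B" "b \<notin> A" "(a, b) \<in> parcs G"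
      "sym_diff A B = {a, b}" "A \<subseteq> pverts G" "B \<subseteq> pverts G" "card A = Suc j" "card B = Suc j"
      by (rule token_graph_arcD)
    have "sym_diff (A - {c}) (B - {c}) = {a, b}" using ab cAB by auto
    moreover have "card (A - {c}) = j" "card (B - {c}) = j" using ab cAB by auto
    ultimately show "(\<lambda>(A, B). (A - {c}, B - {c})) p \<in> ?del"
      using ab cAB unfolding token_graph_def delete_vertex_def by auto
    show "(\<lambda>(A, B). (insert c A, insert c B)) ((\<lambda>(A, B). (A - {c}, B - {c})) p) = p"
      using cAB by auto
  qed (simp add: case_prod_unfold)
  moreover have "(\<Sum>(A, B) | (A, B) \<in> ?E \<and> (c \<in> A \<longleftrightarrow> c \<in> B). (w A - w B)\<^sup>2)
      = (\<Sum>(A, B)\<in>?out. (w A - w B)\<^sup>2) + (\<Sum>(A, B)\<in>?in. (w A - w B)\<^sup>2)"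
    by (subst sum.union_disjoint[symmetric]) (use fin in \<open>auto intro!: sum.cong\<close>)
  ultimately show ?thesis
    unfolding dirichlet_form_def parcs_token_graph_delete_vertex[of "Suc j"] by (simp add: add_divide_distrib)
qed

text \<open>The restrictions of \<open>w\<close> to the tokens containing \<open>c\<close> and to those avoiding \<open>c\<close> both have zero
  sum, and live on token graphs of \<open>G - c\<close>.\<close>

lemma poincare_delete_vertex:
  assumes c: "c \<in> pverts G" and k: "1 \<le> k"
    and poincare: "\<And>j. poincare (token_graph j (delete_vertex G c)) \<nu>"
    and w: "\<And>a. a \<in> pverts G \<Longrightarrow> token_sum k (pverts G) w a = 0"
  shows "\<nu> * (\<Sum>A | A \<subseteq> pverts G \<and> card A = k. (w A)\<^sup>2)
    \<le> (\<Sum>(A, B) | (A, B) \<in> parcs (token_graph k G) \<and> (c \<in> A \<longleftrightarrow> c \<in> B). (w A - w B)\<^sup>2) / 2"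
proof -
  obtain j where j: "k = Suc j" using k by (cases k) auto
  let ?V = "pverts G" and ?D = "delete_vertex G c"
  let ?T = "{A. A \<subseteq> ?V \<and> card A = Suc j}"
  let ?in = "{A. A \<subseteq> ?V - {c} \<and> card A = j}" and ?out = "{A. A \<subseteq> ?V - {c} \<and> card A = Suc j}"
  have fin: "finite ?in" "finite ?out" "finite ?T" using pair_finite_verts by auto
  have split: "sum g ?T = sum g ?out + (\<Sum>A\<in>?in. g (insert c A))" for g :: "'a set \<Rightarrow> real"
  proof -
    have "(\<Sum>A\<in>?in. g (insert c A)) = (\<Sum>A | A \<subseteq> ?V \<and> card A = Suc j \<and> c \<in> A. g A)"
      by (rule sum.reindex_bij_betw[OF bij_betw_insert_token[OF pair_finite_verts c]])
    moreover have "sum g ?T = sum g ?out + (\<Sum>A | A \<subseteq> ?V \<and> card A = Suc j \<and> c \<in> A. g A)"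
      using pair_finite_verts by (subst sum.union_disjoint[symmetric]) (auto intro!: sum.cong)
    ultimately show ?thesis by simp
  qed
  \<comment> \<open>Summing the token sums over all vertices counts each set \<open>k\<close> times.
    The token sum at \<open>c\<close> alone then separates the sets containing \<open>c\<close> from
    those avoiding it.\<close>
  have "real k * sum w ?T = 0"
    using sum_token_sum[OF pair_finite_verts, of k w] w by (simp add: j)
  then have T0: "sum w ?T = 0" using k by simp
  have in0: "(\<Sum>A\<in>?in. w (insert c A)) = 0"
    using w[OF c] sum.reindex_bij_betw[OF bij_betw_insert_token[OF pair_finite_verts c], of w j]
    by (simp add: token_sum_def j)
  with T0 split[of w] have out0: "sum w ?out = 0" by simp
  have pv: "pverts (token_graph i ?D) = {A. A \<subseteq> ?V - {c} \<and> card A = i}" for i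
    by (simp add: pverts_token_graph delete_vertex_def)
  have "\<nu> * (\<Sum>A\<in>?out. (w A)\<^sup>2) \<le> dirichlet_form (token_graph (Suc j) ?D) w"
    using poincareD[OF poincare, of w "Suc j"] out0 unfolding pv by simp
  moreover have "\<nu> * (\<Sum>A\<in>?in. (w (insert c A))\<^sup>2) \<le> dirichlet_form (token_graph j ?D) (\<lambda>A. w (insert c A))"
    using poincareD[OF poincare, of "\<lambda>A. w (insert c A)" j] in0 unfolding pv by simp
  ultimately show ?thesis
    unfolding j dirichlet_form_token_delete_vertex[OF c, symmetric] split by (simp add: distrib_left)
qed

text \<open>Outside this range of \<open>k\<close> the binomial coefficient counting the tokens is
  at most 1.\<close>

lemma poincare_token_graph_trivial:
  assumes "\<not> (1 \<le> k \<and> k < card (pverts G))"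
  shows "poincare (token_graph k G) \<kappa>"
proof (rule poincare_trivial)
  have "card (pverts (token_graph k G)) = card (pverts G) choose k"
    unfolding pverts_token_graph by (rule n_subsets[OF pair_finite_verts])
  also have "\<dots> \<le> 1"
    using assms by (cases "k = card (pverts G)") (auto simp: not_less_eq_eq binomial_eq_0)
  finally show "card (pverts (token_graph k G)) \<le> 1" .
qed

text \<open>Discarding the arcs that move a token onto or off \<open>c\<close> only decreases the
  Dirichlet form, so one vertex suffices if its deletion does not lower the constant.\<close>

lemma poincare_token_graph_by_deletion:
  assumes "poincare G \<kappa>" and c: "c \<in> pverts G"
    and del: "\<And>j. poincare (token_graph j (delete_vertex G c)) \<kappa>"
  shows "poincare (token_graph k G) \<kappa>"
proof (cases "1 \<le> k \<and> k < card (pverts G)")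
  case True
  interpret H: pair_graph "token_graph k G" by (rule pair_graph_token)
  show ?thesis
  proof (rule poincare_token_graphI[OF assms(1)])
    fix w assume w: "\<And>a. a \<in> pverts G \<Longrightarrow> token_sum k (pverts G) w a = 0"
    have "\<kappa> * (\<Sum>A | A \<subseteq> pverts G \<and> card A = k. (w A)\<^sup>2)
      \<le> (\<Sum>(A, B) | (A, B) \<in> parcs (token_graph k G) \<and> (c \<in> A \<longleftrightarrow> c \<in> B). (w A - w B)\<^sup>2) / 2"
      using True by (intro poincare_delete_vertex c del w) auto
    also have "\<dots> \<le> dirichlet_form (token_graph k G) w"
      unfolding dirichlet_form_def
      by (intro divide_right_mono sum_mono2 H.pair_finite_arcs) auto
    finally show "\<kappa> * (\<Sum>A | A \<subseteq> pverts G \<and> card A = k. (w A)\<^sup>2) \<le> dirichlet_form (token_graph k G) w" .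
  qed (use True in auto)
next
  case False
  then show ?thesis by (rule poincare_token_graph_trivial)
qed

text \<open>An arc moving a token from \<open>a\<close> to \<open>b\<close> survives the deletion of every vertex except \<open>a\<close> and \<open>b\<close>,
  hence is counted \<open>n - 2\<close> times.\<close>

lemma poincare_token_graph_by_averaging:
  assumes "poincare G \<kappa>"
    and del: "\<And>c j. c \<in> pverts G \<Longrightarrow> poincare (token_graph j (delete_vertex G c)) (\<nu> c)"
    and avg: "\<kappa> * (real (card (pverts G)) - 2) \<le> (\<Sum>c\<in>pverts G. \<nu> c)"
  shows "poincare (token_graph k G) \<kappa>"
proof (cases "1 \<le> k \<and> k < card (pverts G)")
  case True
  interpret H: pair_graph "token_graph k G" by (rule pair_graph_token)
  let ?V = "pverts G" and ?E = "parcs (token_graph k G)"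
  let ?n = "card ?V"
  show ?thesis
  proof (rule poincare_token_graphI[OF assms(1)])
    fix w assume w: "\<And>a. a \<in> ?V \<Longrightarrow> token_sum k ?V w a = 0"
    let ?s = "\<Sum>A | A \<subseteq> ?V \<and> card A = k. (w A)\<^sup>2"
    have "0 \<le> ?s" by (simp add: sum_nonneg)
    show "\<kappa> * ?s \<le> dirichlet_form (token_graph k G) w"
    \<comment> \<open>For \<open>k = 1\<close> the token sums are the values of \<open>w\<close>
      itself, so \<open>w\<close> vanishes. Otherwise there are at least 3 vertices, and the
      averaging factor \<open>?n - 2\<close> can be cancelled.\<close>
    proof (cases "k = 1")
      case True
      have "w A = 0" if A: "A \<subseteq> ?V" "card A = k" for A
      proof -
        obtain a where a: "A = {a}" using A True by (auto simp: card_1_singleton_iff)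
        then have "{B. B \<subseteq> ?V \<and> card B = k \<and> a \<in> B} = {{a}}"
          using A True by (auto simp: card_1_singleton_iff)
        then show ?thesis using w[of a] A a by (simp add: token_sum_def)
      qed
      then have "?s = 0" by (intro sum.neutral) auto
      then show ?thesis by (simp add: dirichlet_form_nonneg)
    next
      case False
      then have n: "2 < ?n" using True by auto
      have "\<kappa> * (real ?n - 2) * ?s \<le> (\<Sum>c\<in>?V. \<nu> c) * ?s"
        using avg \<open>0 \<le> ?s\<close> by (rule mult_right_mono)
      also have "\<dots> \<le> (\<Sum>c\<in>?V. (\<Sum>(A, B) | (A, B) \<in> ?E \<and> (c \<in> A \<longleftrightarrow> c \<in> B). (w A - w B)\<^sup>2) / 2)"
        unfolding sum_distrib_right using True by (intro sum_mono poincare_delete_vertex del w) auto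
      also have "\<dots> = (\<Sum>c\<in>?V. \<Sum>p | p \<in> ?E \<and> (c \<in> fst p \<longleftrightarrow> c \<in> snd p). (w (fst p) - w (snd p))\<^sup>2) / 2"
        by (simp add: sum_divide_distrib case_prod_unfold)
      also have "(\<Sum>c\<in>?V. \<Sum>p | p \<in> ?E \<and> (c \<in> fst p \<longleftrightarrow> c \<in> snd p). (w (fst p) - w (snd p))\<^sup>2)
          = (\<Sum>p\<in>?E. \<Sum>c | c \<in> ?V \<and> (c \<in> fst p \<longleftrightarrow> c \<in> snd p). (w (fst p) - w (snd p))\<^sup>2)"
        by (rule sum.swap_restrict[OF pair_finite_verts H.pair_finite_arcs])
      also have "\<dots> = (\<Sum>p\<in>?E. (real ?n - 2) * (w (fst p) - w (snd p))\<^sup>2)"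
      proof (rule sum.cong[OF refl])
        fix p assume p: "p \<in> ?E"
        obtain A B where [simp]: "p = (A, B)" by (cases p)
        from p obtain a b where ab: "a \<in> A" "a \<notin> B" "b \<in> B" "b \<notin> A" "sym_diff A B = {a, b}" "(a, b) \<in> parcs G"
          unfolding \<open>p = (A, B)\<close> by (rule token_graph_arcD)
        have "{c \<in> ?V. c \<in> fst p \<longleftrightarrow> c \<in> snd p} = ?V - {a, b}" using ab by auto
        moreover have "card (?V - {a, b}) = ?n - card {a, b}"
          using ab in_arcsD1 in_arcsD2 by (intro card_Diff_subset) auto
        moreover have "a \<noteq> b" using ab by auto
        ultimately show "(\<Sum>c | c \<in> ?V \<and> (c \<in> fst p \<longleftrightarrow> c \<in> snd p). (w (fst p) - w (snd p))\<^sup>2)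
            = (real ?n - 2) * (w (fst p) - w (snd p))\<^sup>2"
          using n by (simp add: of_nat_diff)
      qed
      finally have "(real ?n - 2) * (\<kappa> * ?s) \<le> (real ?n - 2) * dirichlet_form (token_graph k G) w"
        by (simp add: dirichlet_form_def sum_distrib_left[symmetric] case_prod_unfold ac_simps)
      then show ?thesis using n by simp
    qed
  qed (use True in auto)
next
  case False
  then show ?thesis by (rule poincare_token_graph_trivial)
qed

text \<open>The lift of an eigenfunction is an eigenfunction for the same eigenvalue. It is nonzero,
  since its token sums return a positive multiple of \<open>u\<close>.\<close>

lemma algebraic_connectivity_token_graph:
  assumes "0 < \<kappa>" and poincare: "poincare G \<kappa>" "poincare (token_graph k G) \<kappa>"
    and eig: "\<And>x. x \<in> pverts G \<Longrightarrow> laplacian G u x = \<kappa> * u x"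
    and nz: "x0 \<in> pverts G" "u x0 \<noteq> 0"
    and k: "1 \<le> k" "k < card (pverts G)"
  shows "algebraic_connectivity (token_graph k G) = \<kappa>" "algebraic_connectivity G = \<kappa>"
proof -
  interpret H: pair_graph "token_graph k G" by (rule pair_graph_token)
  show "algebraic_connectivity G = \<kappa>"
    by (rule algebraic_connectivity_eqI[OF assms(1) poincare(1) eig nz])
  have sum_u: "sum u (pverts G) = 0"
    by (rule eigenfunction_sum_zero[OF eig]) (use \<open>0 < \<kappa>\<close> in simp_all)
  have "\<exists>A. A \<subseteq> pverts G \<and> card A = k \<and> sum u A \<noteq> 0"
  proof (rule ccontr)
    assume "\<not> ?thesis"
    then have "token_sum k (pverts G) (sum u) x0 = 0"
      unfolding token_sum_def by (intro sum.neutral) auto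
    then have "real ((card (pverts G) - 2) choose (k - 1)) * u x0 = 0"
      using token_sum_lift[OF pair_finite_verts nz(1) k(1) sum_u] by simp
    with nz k show False by (simp add: binomial_eq_0_iff)
  qed
  then obtain A where A: "A \<in> pverts (token_graph k G)" "sum u A \<noteq> 0"
    by (auto simp: pverts_token_graph)
  show "algebraic_connectivity (token_graph k G) = \<kappa>"
  proof (rule H.algebraic_connectivity_eqI[OF assms(1) poincare(2) _ A(1), where f = "sum u"])
    fix B assume "B \<in> pverts (token_graph k G)"
    then have B: "B \<subseteq> pverts G" "card B = k" by (auto simp: pverts_token_graph)
    have "laplacian (token_graph k G) (sum u) B = (\<Sum>a\<in>B. \<kappa> * u a)"
      unfolding laplacian_token_graph_lift[OF B] by (rule sum.cong) (use B eig in auto)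
    then show "laplacian (token_graph k G) (sum u) B = \<kappa> * sum u B"
      by (simp add: sum_distrib_left)
  qed (rule A(2))
qed

end

subsection \<open>Complete graphs\<close>

text \<open>Arbitrary vertex sets make the family closed under vertex deletion, as the induction
  requires.\<close>

definition complete_on :: "'a set \<Rightarrow> 'a pair_pre_digraph" where
  "complete_on V = \<lparr> pverts = V, parcs = {(x, y). x \<in> V \<and> y \<in> V \<and> x \<noteq> y} \<rparr>"

lemma pair_graph_complete_on:
  assumes "finite V"
  shows "pair_graph (complete_on V)"
proof -
  have "finite {(x, y). x \<in> V \<and> y \<in> V \<and> x \<noteq> y}"
    by (rule finite_subset[of _ "V \<times> V"]) (use assms in auto)
  then show ?thesis
    using assms by unfold_locales (auto simp: complete_on_def symmetric_def intro: symI)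
qed

lemma laplacian_complete_on:
  assumes "finite V" "x \<in> V"
  shows "laplacian (complete_on V) f x = real (card V) * f x - sum f V"
proof -
  have "laplacian (complete_on V) f x = (\<Sum>y\<in>V. f x - f y)"
    unfolding laplacian_def using assms
    by (intro sum.mono_neutral_left) (auto simp: complete_on_def)
  then show ?thesis by (simp add: sum_subtractf)
qed

lemma poincare_complete_on:
  fixes V :: "'a set"
  assumes "finite V"
  shows "poincare (complete_on V) (real (card V))"
proof (rule poincareI)
  interpret pair_graph "complete_on V" using assms by (rule pair_graph_complete_on)
  have pv: "pverts (complete_on V) = V" by (simp add: complete_on_def)
  fix f :: "'a \<Rightarrow> real" assume "sum f (pverts (complete_on V)) = 0"
  then have "dirichlet_form (complete_on V) f = (\<Sum>x\<in>V. real (card V) * f x * f x)"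
    unfolding dirichlet_form_eq pv
    by (intro sum.cong refl) (simp add: laplacian_complete_on[OF assms])
  then show "real (card V) * (\<Sum>x\<in>pverts (complete_on V). (f x)\<^sup>2) \<le> dirichlet_form (complete_on V) f"
    by (simp add: pv sum_distrib_left power2_eq_square ac_simps)
qed

text \<open>With n vertices, each of the n deletions supplies the constant n - 1, and n (n - 1) is
  at least the n (n - 2) needed for averaging.\<close>

lemma poincare_token_complete_on:
  assumes "finite V"
  shows "poincare (token_graph k (complete_on V)) (real (card V))"
  using assms
proof (induction "card V" arbitrary: V k rule: less_induct)
  case less
  interpret pair_graph "complete_on V" using less.prems by (rule pair_graph_complete_on)
  have pv: "pverts (complete_on V) = V" by (simp add: complete_on_def)
  show ?case
  proof (rule poincare_token_graph_by_averaging)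
    fix c j assume "c \<in> pverts (complete_on V)"
    then have c: "c \<in> V" by (simp add: pv)
    have "delete_vertex (complete_on V) c = complete_on (V - {c})"
      by (auto simp: delete_vertex_def complete_on_def)
    moreover have "card (V - {c}) < card V"
      using c less.prems by (rule card_Diff1_less[rotated])
    ultimately show "poincare (token_graph j (delete_vertex (complete_on V) c)) (real (card (V - {c})))"
      using less by simp
  next
    have "(\<Sum>c\<in>V. real (card (V - {c}))) = real (card V) * (real (card V) - 1)"
    proof -
      have "(\<Sum>c\<in>V. real (card (V - {c}))) = (\<Sum>c\<in>V. real (card V) - 1)"
      proof (rule sum.cong[OF refl])
        fix c assume "c \<in> V"
        with less.prems have "Suc (card (V - {c})) = card V" by (rule card_Suc_Diff1)
        then show "real (card (V - {c})) = real (card V) - 1" by linarith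
      qed
      then show ?thesis by simp
    qed
    then show "real (card V) * (real (card (pverts (complete_on V))) - 2)
        \<le> (\<Sum>c\<in>pverts (complete_on V). real (card (V - {c})))"
      by (simp add: pv mult_left_mono)
  qed (rule poincare_complete_on[OF less.prems])
qed

lemma algebraic_connectivity_complete_graph:
  assumes "1 \<le> k" "k < n"
  shows "algebraic_connectivity (token_graph k (complete_graph n)) = real n"
    "algebraic_connectivity (complete_graph n) = real n"
proof -
  have eq: "complete_graph n = complete_on {1..n}"
    by (simp add: complete_graph_def complete_on_def)
  interpret pair_graph "complete_graph n"
    unfolding eq by (rule pair_graph_complete_on) simp
  have pv: "pverts (complete_graph n) = {1..n}" by (simp add: complete_graph_def)
  \<comment> \<open>A difference of two point masses; both vertices exist because
    \<open>1 \<le> k < n\<close>.\<close>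
  let ?u = "\<lambda>i :: nat. if i = 1 then 1 else if i = 2 then - 1 else 0 :: real"
  have "sum ?u {1..n} = sum ?u {1, 2}"
    by (rule sum.mono_neutral_right) (use assms in auto)
  then have u: "laplacian (complete_graph n) ?u x = real n * ?u x" if "x \<in> pverts (complete_graph n)" for x
    using that unfolding eq pv[unfolded eq] by (subst laplacian_complete_on) auto
  have "poincare (complete_graph n) (real n)" "poincare (token_graph k (complete_graph n)) (real n)"
    using poincare_complete_on[of "{1..n}"] poincare_token_complete_on[of "{1..n}" k] by (simp_all add: eq)
  note * = algebraic_connectivity_token_graph[OF _ this u, of 1]
  show "algebraic_connectivity (token_graph k (complete_graph n)) = real n"
    by (rule *(1)) (use assms in \<open>simp_all add: pv\<close>)
  show "algebraic_connectivity (complete_graph n) = real n"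
    by (rule *(2)) (use assms in \<open>simp_all add: pv\<close>)
qed

subsection \<open>Complete bipartite graphs\<close>

definition complete_bipartite_on :: "'a set \<Rightarrow> 'a set \<Rightarrow> 'a pair_pre_digraph" where
  "complete_bipartite_on M N = \<lparr> pverts = M \<union> N, parcs = M \<times> N \<union> N \<times> M \<rparr>"

lemma pair_graph_complete_bipartite_on:
  assumes "finite M" "finite N" "M \<inter> N = {}"
  shows "pair_graph (complete_bipartite_on M N)"
  using assms by unfold_locales (auto simp: complete_bipartite_on_def symmetric_def intro: symI)

lemma laplacian_complete_bipartite_on:
  assumes "M \<inter> N = {}"
  shows "x \<in> M \<Longrightarrow> laplacian (complete_bipartite_on M N) f x = real (card N) * f x - sum f N"
    and "x \<in> N \<Longrightarrow> laplacian (complete_bipartite_on M N) f x = real (card M) * f x - sum f M"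
proof -
  assume "x \<in> M"
  then have "{y. (x, y) \<in> parcs (complete_bipartite_on M N)} = N"
    using assms by (auto simp: complete_bipartite_on_def)
  then show "laplacian (complete_bipartite_on M N) f x = real (card N) * f x - sum f N"
    by (simp add: laplacian_def sum_subtractf)
next
  assume "x \<in> N"
  then have "{y. (x, y) \<in> parcs (complete_bipartite_on M N)} = M"
    using assms by (auto simp: complete_bipartite_on_def)
  then show "laplacian (complete_bipartite_on M N) f x = real (card M) * f x - sum f M"
    by (simp add: laplacian_def sum_subtractf)
qed

text \<open>For zero-sum functions the mixed terms of the Dirichlet form combine to the square
  \<open>2 * (sum f N)\<^sup>2\<close>. The constant is a minimum because deletions may exchange
  which side is smaller.\<close>

lemma poincare_complete_bipartite_on:
  fixes M N :: "'a set"
  assumes "finite M" "finite N" "M \<inter> N = {}"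
  shows "poincare (complete_bipartite_on M N) (real (min (card M) (card N)))"
proof (rule poincareI)
  let ?G = "complete_bipartite_on M N" and ?m = "real (card M)" and ?n = "real (card N)"
  let ?\<kappa> = "real (min (card M) (card N))"
  interpret pair_graph ?G using assms by (rule pair_graph_complete_bipartite_on)
  have pv: "pverts ?G = M \<union> N" by (simp add: complete_bipartite_on_def)
  fix f :: "'a \<Rightarrow> real" assume "sum f (pverts ?G) = 0"
  then have S: "sum f M = - sum f N"
    by (simp add: pv sum.union_disjoint[OF assms])
  have "dirichlet_form ?G f = (\<Sum>x\<in>M. laplacian ?G f x * f x) + (\<Sum>x\<in>N. laplacian ?G f x * f x)"
    unfolding dirichlet_form_eq pv by (rule sum.union_disjoint[OF assms])
  also have "(\<Sum>x\<in>M. laplacian ?G f x * f x) = ?n * (\<Sum>x\<in>M. (f x)\<^sup>2) - sum f N * sum f M"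
    by (simp add: laplacian_complete_bipartite_on[OF assms(3)] left_diff_distrib sum_subtractf
        sum_distrib_left[symmetric] power2_eq_square mult.assoc)
  also have "(\<Sum>x\<in>N. laplacian ?G f x * f x) = ?m * (\<Sum>x\<in>N. (f x)\<^sup>2) - sum f M * sum f N"
    by (simp add: laplacian_complete_bipartite_on[OF assms(3)] left_diff_distrib sum_subtractf
        sum_distrib_left[symmetric] power2_eq_square mult.assoc)
  finally have D: "dirichlet_form ?G f = ?n * (\<Sum>x\<in>M. (f x)\<^sup>2) + ?m * (\<Sum>x\<in>N. (f x)\<^sup>2) + 2 * (sum f N)\<^sup>2"
    by (simp add: S power2_eq_square)
  have "?\<kappa> * (\<Sum>x\<in>pverts ?G. (f x)\<^sup>2) = ?\<kappa> * (\<Sum>x\<in>M. (f x)\<^sup>2) + ?\<kappa> * (\<Sum>x\<in>N. (f x)\<^sup>2)"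
    by (simp only: pv sum.union_disjoint[OF assms] distrib_left)
  also have "\<dots> \<le> ?n * (\<Sum>x\<in>M. (f x)\<^sup>2) + ?m * (\<Sum>x\<in>N. (f x)\<^sup>2)"
    by (intro add_mono mult_right_mono sum_nonneg) auto
  also have "\<dots> \<le> dirichlet_form ?G f" by (simp add: D)
  finally show "?\<kappa> * (\<Sum>x\<in>pverts ?G. (f x)\<^sup>2) \<le> dirichlet_form ?G f" .
qed

text \<open>The averaging condition for complete bipartite graphs. Deleting from the larger side
  keeps the minimum; for \<open>m = n\<close> every deletion lowers it, and equality holds.\<close>

lemma min_deletion_average:
  fixes m n :: nat
  shows "real (min m n) * (real (m + n) - 2) \<le> real m * real (min (m - 1) n) + real n * real (min m (n - 1))"
proof (cases "m = 0 \<or> n = 0")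
  case False
  show ?thesis
  proof (cases m n rule: linorder_cases)
    case less
    then have "min (m - 1) n = m - 1" "min m (n - 1) = m" "min m n = m" by auto
    with False show ?thesis by (simp add: of_nat_diff algebra_simps)
  next
    case equal
    with False show ?thesis by (simp add: of_nat_diff algebra_simps)
  next
    case greater
    then have "min (m - 1) n = n" "min m (n - 1) = n - 1" "min m n = n" by auto
    with False show ?thesis by (simp add: of_nat_diff algebra_simps)
  qed
qed auto

lemma poincare_token_complete_bipartite_on:
  assumes "finite M" "finite N" "M \<inter> N = {}"
  shows "poincare (token_graph k (complete_bipartite_on M N)) (real (min (card M) (card N)))"
  using assms
proof (induction "card M + card N" arbitrary: M N k rule: less_induct)
  case less
  let ?G = "complete_bipartite_on M N"
  interpret pair_graph ?G using less.prems by (rule pair_graph_complete_bipartite_on)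
  have pv: "pverts ?G = M \<union> N" by (simp add: complete_bipartite_on_def)
  let ?\<nu> = "\<lambda>c. if c \<in> M then real (min (card M - 1) (card N)) else real (min (card M) (card N - 1))"
  show ?case
  proof (rule poincare_token_graph_by_averaging)
    fix c j assume "c \<in> pverts ?G"
    then have c: "c \<in> M \<or> c \<in> N" by (simp add: pv)
    have del: "delete_vertex ?G c = complete_bipartite_on (M - {c}) (N - {c})"
      by (auto simp: delete_vertex_def complete_bipartite_on_def)
    have "c \<notin> M \<or> c \<notin> N" using less.prems(3) by blast
    then have cards: "card (M - {c}) = (if c \<in> M then card M - 1 else card M)"
      "card (N - {c}) = (if c \<in> M then card N else card N - 1)"
      using c less.prems by auto
    moreover have "card (M - {c}) + card (N - {c}) < card M + card N"
      using c less.prems by (auto simp: cards card_gt_0_iff intro!: diff_less)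
    then have "poincare (token_graph j (complete_bipartite_on (M - {c}) (N - {c})))
        (real (min (card (M - {c})) (card (N - {c}))))"
      using less.prems by (intro less.hyps) auto
    ultimately show "poincare (token_graph j (delete_vertex ?G c)) (?\<nu> c)"
      by (simp add: del split: if_splits)
  next
    have "(\<Sum>c\<in>pverts ?G. ?\<nu> c) = (\<Sum>c\<in>M. ?\<nu> c) + (\<Sum>c\<in>N. ?\<nu> c)"
      unfolding pv by (rule sum.union_disjoint[OF less.prems])
    also have "(\<Sum>c\<in>N. ?\<nu> c) = (\<Sum>c\<in>N. real (min (card M) (card N - 1)))"
      using less.prems by (intro sum.cong refl) auto
    finally have "(\<Sum>c\<in>pverts ?G. ?\<nu> c)
        = real (card M) * real (min (card M - 1) (card N)) + real (card N) * real (min (card M) (card N - 1))"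
      by simp
    moreover have "card (pverts ?G) = card M + card N"
      unfolding pv by (rule card_Un_disjoint[OF less.prems])
    ultimately show "real (min (card M) (card N)) * (real (card (pverts ?G)) - 2) \<le> (\<Sum>c\<in>pverts ?G. ?\<nu> c)"
      using min_deletion_average[of "card M" "card N"] by simp
  qed (rule poincare_complete_bipartite_on[OF less.prems])
qed

text \<open>The eigenfunction is a difference of two point masses on the larger side, which must
  therefore have two vertices.\<close>

lemma algebraic_connectivity_complete_bipartite_graph:
  assumes "1 \<le> k" "k < m + n" "1 \<le> m" "m \<le> n" "2 \<le> n"
  shows "algebraic_connectivity (token_graph k (complete_bipartite_graph m n)) = real m"
    "algebraic_connectivity (complete_bipartite_graph m n) = real m"
proof -
  let ?M = "{1..m}" and ?N = "{m + 1..m + n}"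
  let ?G = "complete_bipartite_graph m n"
  have eq: "?G = complete_bipartite_on ?M ?N"
    by (auto simp: complete_bipartite_graph_def complete_bipartite_on_def)
  have disj: "?M \<inter> ?N = {}" by auto
  interpret pair_graph ?G
    unfolding eq by (rule pair_graph_complete_bipartite_on) auto
  have pv: "pverts ?G = {1..m + n}" by (simp add: complete_bipartite_graph_def)
  let ?u = "\<lambda>i :: nat. if i = m + 1 then 1 else if i = m + 2 then - 1 else 0 :: real"
  have "sum ?u ?N = sum ?u {m + 1, m + 2}"
    by (rule sum.mono_neutral_right) (use assms in auto)
  then have sN: "sum ?u ?N = 0" by simp
  have sM: "sum ?u ?M = 0" by (rule sum.neutral) auto
  have u: "laplacian ?G ?u x = real m * ?u x" if "x \<in> pverts ?G" for x
  proof (cases "x \<in> ?M")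
    case True
    show ?thesis
      unfolding eq laplacian_complete_bipartite_on(1)[OF disj True] sN using True by simp
  next
    case False
    then have "x \<in> ?N" using that by (auto simp: pv)
    then show ?thesis
      unfolding eq laplacian_complete_bipartite_on(2)[OF disj \<open>x \<in> ?N\<close>] sM by simp
  qed
  have "poincare ?G (real m)" "poincare (token_graph k ?G) (real m)"
    using poincare_complete_bipartite_on[of ?M ?N] poincare_token_complete_bipartite_on[of ?M ?N k]
      disj \<open>m \<le> n\<close> by (simp_all add: eq min_def)
  note * = algebraic_connectivity_token_graph[OF _ this u, of "m + 1"]
  show "algebraic_connectivity (token_graph k ?G) = real m"
    by (rule *(1)) (use assms in \<open>simp_all add: pv\<close>)
  show "algebraic_connectivity ?G = real m"
    by (rule *(2)) (use assms in \<open>simp_all add: pv\<close>)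
qed

subsection \<open>Path graphs\<close>

text \<open>Picone's identity with the positive ground state \<open>sin (i * \<pi> / n)\<close>.\<close>

lemma dirichlet_path_bound:
  fixes S :: "nat \<Rightarrow> real"
  assumes n: "2 \<le> n" and S: "S 0 = 0" "S n = 0"
  shows "2 * (1 - cos (pi / n)) * (\<Sum>i = 1..<n. (S i)\<^sup>2) \<le> (\<Sum>i<n. (S (Suc i) - S i)\<^sup>2)"
proof -
  define \<theta> where "\<theta> = pi / n"
  define s where "s = (\<lambda>i :: nat. sin (i * \<theta>))"
  let ?\<kappa> = "2 * (1 - cos \<theta>)"
  have pos: "0 < s i" if "0 < i" "i < n" for i
    unfolding s_def \<theta>_def using that n by (intro sin_gt_zero) (auto simp: field_simps)
  have rec: "s (Suc (Suc i)) + s i = 2 * cos \<theta> * s (Suc i)" for i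
  proof -
    have "real i * \<theta> = real (Suc i) * \<theta> - \<theta>" "real (Suc (Suc i)) * \<theta> = real (Suc i) * \<theta> + \<theta>"
      by (simp_all add: algebra_simps)
    then show ?thesis by (simp only: s_def sin_add sin_diff) simp
  qed
  have young: "2 * x * y \<le> r * x\<^sup>2 + y\<^sup>2 / r" if "0 < r" for x y r :: real
  proof -
    have "0 \<le> (r * x - y)\<^sup>2 / r" using that by simp
    also have "\<dots> = r * x\<^sup>2 + y\<^sup>2 / r - 2 * x * y"
      using that by (simp add: field_simps power2_eq_square)
    finally show ?thesis by simp
  qed
  \<comment> \<open>The boundary term carries the ratio of consecutive ground state values; by
    \<open>rec\<close> this ratio obeys a Riccati recursion, which drives the induction.\<close>
  have step: "?\<kappa> * (\<Sum>i = 1..m. (S i)\<^sup>2) + (S (Suc m))\<^sup>2 * (1 - s m / s (Suc m))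
      \<le> (\<Sum>i<Suc m. (S (Suc i) - S i)\<^sup>2)" if "Suc m < n" for m
    using that
  proof (induction m)
    case 0
    then show ?case by (simp add: S s_def)
  next
    case (Suc m)
    let ?x = "S (Suc m)" and ?y = "S (Suc (Suc m))"
    let ?r = "s (Suc (Suc m)) / s (Suc m)"
    have p: "0 < s (Suc m)" "0 < s (Suc (Suc m))" using Suc.prems by (auto intro: pos)
    have "s m / s (Suc m) + ?r = 2 * cos \<theta>"
      using rec[of m] p by (simp add: field_simps)
    then have r: "1 - s m / s (Suc m) = ?\<kappa> - 1 + ?r" by simp
    \<comment> \<open>Young's inequality weighted by the ground state ratio, an equality when
      \<open>S\<close> is proportional to \<open>s\<close>.\<close>
    have "2 * ?x * ?y \<le> ?r * ?x\<^sup>2 + ?y\<^sup>2 * (s (Suc m) / s (Suc (Suc m)))"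
      using young[of ?r ?x ?y] p by simp
    then have "?x\<^sup>2 * (1 - ?r) + ?y\<^sup>2 * (1 - s (Suc m) / s (Suc (Suc m))) \<le> (?y - ?x)\<^sup>2"
      by (simp add: power2_eq_square algebra_simps)
    moreover have "?\<kappa> * (\<Sum>i = 1..m. (S i)\<^sup>2) + ?x\<^sup>2 * (?\<kappa> - 1 + ?r) \<le> (\<Sum>i<Suc m. (S (Suc i) - S i)\<^sup>2)"
      using Suc unfolding r by simp
    ultimately show ?case by (simp add: algebra_simps)
  qed
  define m where "m = n - 2"
  then have m: "n = Suc (Suc m)" using n by simp
  \<comment> \<open>At the right end the recursion gives the ratio \<open>2 * cos \<theta>\<close>.
    The last edge, to \<open>S n = 0\<close>, supplies the one copy of
    \<open>(S (Suc m))\<^sup>2\<close> still missing.\<close>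
  have "s n = 0" using n by (simp add: s_def \<theta>_def)
  then have "s m = 2 * cos \<theta> * s (Suc m)" using rec[of m] m by simp
  moreover have "0 < s (Suc m)" using pos m by simp
  ultimately have "1 - s m / s (Suc m) = ?\<kappa> - 1" by simp
  then have "?\<kappa> * (\<Sum>i = 1..m. (S i)\<^sup>2) + (S (Suc m))\<^sup>2 * (?\<kappa> - 1) \<le> (\<Sum>i<Suc m. (S (Suc i) - S i)\<^sup>2)"
    using step[of m] m by simp
  moreover have "{1..<n} = insert (Suc m) {1..m}" using m by auto
  ultimately have "?\<kappa> * (\<Sum>i = 1..<n. (S i)\<^sup>2) \<le> (\<Sum>i<n. (S (Suc i) - S i)\<^sup>2)"
    using S(2) unfolding m by (simp add: algebra_simps)
  then show ?thesis by (simp add: \<theta>_def)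
qed

text \<open>The Neumann problem for \<open>f\<close> is dual to the Dirichlet problem for the partial sums \<open>S\<close> of \<open>f\<close>:
  with \<open>\<Sum>f\<^sup>2 = \<Sum>S i * (f i - f (i + 1))\<close>, expanding \<open>0 \<le> \<Sum>(\<kappa> * S i - (f i - f (i + 1)))\<^sup>2\<close> transfers the
  bound.\<close>

lemma neumann_path_bound:
  fixes f :: "nat \<Rightarrow> real"
  assumes n: "2 \<le> n" and sum0: "(\<Sum>i = 1..n. f i) = 0"
  defines "\<kappa> \<equiv> 2 * (1 - cos (pi / n))"
  shows "\<kappa> * (\<Sum>i = 1..n. (f i)\<^sup>2) \<le> (\<Sum>i = 1..<n. (f i - f (i + 1))\<^sup>2)"
proof -
  define S where "S = (\<lambda>i. \<Sum>j = 1..i. f j)"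
  define X where "X = (\<Sum>i = 1..n. (f i)\<^sup>2)"
  define Y where "Y = (\<Sum>i = 1..<n. (S i)\<^sup>2)"
  define D where "D = (\<Sum>i = 1..<n. (f i - f (i + 1))\<^sup>2)"
  have "0 \<le> \<kappa>" by (simp add: \<kappa>_def)
  have SS: "S (Suc i) = S i + f (Suc i)" for i by (simp add: S_def)
  have "X = (\<Sum>i<n. (S (Suc i) - S i)\<^sup>2)"
    by (simp add: X_def SS sum.atLeast1_atMost_eq)
  moreover have "S 0 = 0" "S n = 0" using sum0 by (simp_all add: S_def)
  ultimately have "\<kappa> * Y \<le> X"
    unfolding Y_def \<kappa>_def using dirichlet_path_bound[OF n] by simp
  \<comment> \<open>Summation by parts. For \<open>m = n - 1\<close> the boundary term becomes the
    missing \<open>(f n)\<^sup>2\<close>, because \<open>S n = 0\<close>.\<close>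
  have parts: "(\<Sum>i = 1..m. S i * (f i - f (i + 1))) = (\<Sum>i = 1..m. (f i)\<^sup>2) - S m * f (Suc m)" for m
    by (induction m) (simp_all add: SS power2_eq_square algebra_simps, simp add: S_def)
  obtain m where m: "n = Suc m" using n by (cases n) auto
  have "{1..<n} = {1..m}" using m by auto
  then have X: "(\<Sum>i = 1..<n. S i * (f i - f (i + 1))) = X"
    using parts[of m] SS[of m] \<open>S n = 0\<close> by (simp add: X_def m power2_eq_square eq_neg_iff_add_eq_0[symmetric])
  have "0 \<le> (\<Sum>i = 1..<n. (\<kappa> * S i - (f i - f (i + 1)))\<^sup>2)"
    by (simp add: sum_nonneg)
  also have "\<dots> = \<kappa> * (\<kappa> * Y) - 2 * \<kappa> * X + D"
    unfolding X[symmetric] Y_def D_def sum_distrib_left sum_subtractf[symmetric] sum.distrib[symmetric]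
    by (rule sum.cong) (auto simp: power2_eq_square algebra_simps)
  also have "\<dots> \<le> \<kappa> * X - 2 * \<kappa> * X + D"
    using mult_left_mono[OF \<open>\<kappa> * Y \<le> X\<close> \<open>0 \<le> \<kappa>\<close>] by (simp add: mult.commute[of X])
  finally show ?thesis by (simp add: X_def D_def)
qed

section \<open>Token graphs and eigenfunctions of paths\<close>

lemma dirichlet_form_path_graph:
  "dirichlet_form (path_graph n) f = (\<Sum>i = 1..<n. (f i - f (i + 1))\<^sup>2)"
proof -
  let ?up = "(\<lambda>i. (i, i + 1)) ` {1..<n}" and ?down = "(\<lambda>i. (i + 1, i)) ` {1..<n}"
  have "parcs (path_graph n) = ?up \<union> ?down"
    by (auto simp: path_graph_def image_iff)
  then have "(\<Sum>(i, j)\<in>parcs (path_graph n). (f i - f j)\<^sup>2)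
      = (\<Sum>(i, j)\<in>?up. (f i - f j)\<^sup>2) + (\<Sum>(i, j)\<in>?down. (f i - f j)\<^sup>2)"
    by (simp only:) (rule sum.union_disjoint, auto)
  also have "(\<Sum>(i, j)\<in>?up. (f i - f j)\<^sup>2) = (\<Sum>i = 1..<n. (f i - f (i + 1))\<^sup>2)"
    by (subst sum.reindex) (auto simp: inj_on_def)
  also have "(\<Sum>(i, j)\<in>?down. (f i - f j)\<^sup>2) = (\<Sum>i = 1..<n. (f i - f (i + 1))\<^sup>2)"
    by (subst sum.reindex) (auto simp: inj_on_def power2_commute)
  finally show ?thesis by (simp add: dirichlet_form_def)
qed

lemma poincare_path_graph: "poincare (path_graph n) (2 * (1 - cos (pi / real n)))"
proof (cases "2 \<le> n")
  case True
  show ?thesis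
  proof (rule poincareI)
    fix f :: "nat \<Rightarrow> real" assume "sum f (pverts (path_graph n)) = 0"
    then show "2 * (1 - cos (pi / real n)) * (\<Sum>x\<in>pverts (path_graph n). (f x)\<^sup>2)
        \<le> dirichlet_form (path_graph n) f"
      using neumann_path_bound[OF True, of f] unfolding dirichlet_form_path_graph
      by (simp add: path_graph_def)
  qed
next
  case False
  then show ?thesis by (intro poincare_trivial) (simp add: path_graph_def)
qed

lemma poincare_token_path_graph: "poincare (token_graph k (path_graph n)) (2 * (1 - cos (pi / real n)))"
proof (induction n arbitrary: k)
  case 0
  interpret pair_graph "path_graph 0" by (rule pair_graph_path_graph)
  show ?case by (rule poincare_token_graph_trivial) (simp add: path_graph_def)
next
  case (Suc n)
  interpret pair_graph "path_graph (Suc n)" by (rule pair_graph_path_graph)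
  interpret P: pair_graph "path_graph n" by (rule pair_graph_path_graph)
  have del: "delete_vertex (path_graph (Suc n)) (Suc n) = path_graph n"
    by (auto simp: delete_vertex_def path_graph_def)
  show ?case
  proof (rule poincare_token_graph_by_deletion[OF poincare_path_graph, of "Suc n"])
    show "poincare (token_graph j (delete_vertex (path_graph (Suc n)) (Suc n))) (2 * (1 - cos (pi / real (Suc n))))" for j
    \<comment> \<open>Division by zero makes the induction hypothesis for \<open>n = 0\<close> yield
      only the constant 0, so the empty path is treated directly.\<close>
    proof (cases "n = 0")
      case True
      then show ?thesis
        unfolding del by (intro P.poincare_token_graph_trivial) (simp add: path_graph_def)
    next
      case False
      have "cos (pi / real n) \<le> cos (pi / real (Suc n))"
        using False by (intro cos_monotone_0_pi_le) (auto simp: field_simps)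
      then show ?thesis
        unfolding del by (intro poincare_antimono[OF Suc.IH]) simp
    qed
  qed (simp add: path_graph_def)
qed

lemma algebraic_connectivity_path_graph:
  assumes "1 \<le> k" "k < n"
  shows "algebraic_connectivity (token_graph k (path_graph n)) = 2 * (1 - cos (pi / real n))"
    "algebraic_connectivity (path_graph n) = 2 * (1 - cos (pi / real n))"
proof -
  interpret pair_graph "path_graph n" by (rule pair_graph_path_graph)
  have pv: "pverts (path_graph n) = {1..n}" by (simp add: path_graph_def)
  define \<theta> where "\<theta> = pi / real n"
  \<comment> \<open>The half-integer shift makes \<open>u\<close> symmetric about 1/2 and n + 1/2,
    so that it takes equal values at 0 and 1, and at n and n + 1.\<close>
  define u where "u = (\<lambda>i :: nat. cos ((real i - 1 / 2) * \<theta>))"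
  have \<theta>: "0 < \<theta>" "\<theta> \<le> pi / 2" "real n * \<theta> = pi"
    using assms by (auto simp: \<theta>_def field_simps)
  have rec: "u i + u (i + 2) = 2 * cos \<theta> * u (i + 1)" for i
  proof -
    have "(real i - 1 / 2) * \<theta> = (real (i + 1) - 1 / 2) * \<theta> - \<theta>"
      "(real (i + 2) - 1 / 2) * \<theta> = (real (i + 1) - 1 / 2) * \<theta> + \<theta>"
      by (simp_all add: algebra_simps)
    then show ?thesis by (simp only: u_def cos_add cos_diff) simp
  qed
  have first: "u 0 = u 1"
    by (simp add: u_def)
  have last: "u (n + 1) = u n"
  proof -
    have "(real (n + 1) - 1 / 2) * \<theta> = pi + \<theta> / 2" "(real n - 1 / 2) * \<theta> = pi - \<theta> / 2"
      using \<theta>(3) by (simp_all add: algebra_simps)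
    then show ?thesis by (simp only: u_def cos_add cos_diff) simp
  qed
  have u: "laplacian (path_graph n) u x = 2 * (1 - cos \<theta>) * u x" if "x \<in> pverts (path_graph n)" for x
  proof -
    from that obtain i where i: "x = i + 1" "i + 1 \<le> n"
      by (auto simp: pv dest: le_Suc_ex)
    have nb: "{y. (x, y) \<in> parcs (path_graph n)} = {i, i + 2} \<inter> {1..n}"
      using i by (auto simp: path_graph_def)
    \<comment> \<open>By these reflections the phantom neighbours 0 and n + 1 contribute nothing,
      and end vertices obey the same recurrence as inner ones.\<close>
    have "laplacian (path_graph n) u x = (\<Sum>y\<in>{i, i + 2}. u x - u y)"
      unfolding laplacian_def nb
    proof (rule sum.mono_neutral_left)
      show "\<forall>y\<in>{i, i + 2} - {i, i + 2} \<inter> {1..n}. u x - u y = 0"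
      proof
        fix y assume "y \<in> {i, i + 2} - {i, i + 2} \<inter> {1..n}"
        then consider "y = 0" "i = 0" | "y = n + 1" "x = n" using i by fastforce
        then show "u x - u y = 0" using i first last by cases auto
      qed
    qed auto
    also have "\<dots> = 2 * (1 - cos \<theta>) * u x"
      using rec[of i] i by (simp add: algebra_simps)
    finally show ?thesis .
  qed
  have "cos \<theta> < 1"
    using cos_monotone_0_pi[of 0 \<theta>] \<theta> by simp
  have "0 < u 1"
    unfolding u_def using \<theta> by (intro cos_gt_zero) auto
  have "poincare (path_graph n) (2 * (1 - cos \<theta>))" "poincare (token_graph k (path_graph n)) (2 * (1 - cos \<theta>))"
    unfolding \<theta>_def by (rule poincare_path_graph poincare_token_path_graph)+
  note * = algebraic_connectivity_token_graph[OF _ this u, of 1, folded \<theta>_def]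
  show "algebraic_connectivity (token_graph k (path_graph n)) = 2 * (1 - cos (pi / real n))"
    unfolding \<theta>_def[symmetric]
    by (rule *(1)) (use assms \<open>cos \<theta> < 1\<close> \<open>0 < u 1\<close> in \<open>simp_all add: pv\<close>)
  show "algebraic_connectivity (path_graph n) = 2 * (1 - cos (pi / real n))"
    unfolding \<theta>_def[symmetric]
    by (rule *(2)) (use assms \<open>cos \<theta> < 1\<close> \<open>0 < u 1\<close> in \<open>simp_all add: pv\<close>)
qed

subsection \<open>The four families\<close>

text \<open>The single edge is both the star on 2 vertices and \<open>K_{1,1}\<close>, and its
  algebraic connectivity is 2. The values 1 and \<open>n1\<close> are therefore claimed only away
  from it, while the equality with the token graph includes it.\<close>

theorem theorem7p2:
  shows
    "(\<forall>n k :: nat. 1 \<le> k \<and> k \<le> n - 1 \<longrightarrow>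
        algebraic_connectivity (token_graph k (complete_graph n))
          = algebraic_connectivity (complete_graph n) \<and>
        algebraic_connectivity (complete_graph n) = real n)
   \<and> (\<forall>n k :: nat. 1 \<le> k \<and> k \<le> n - 1 \<longrightarrow>
        algebraic_connectivity (token_graph k (star_graph n))
          = algebraic_connectivity (star_graph n) \<and>
        (n \<noteq> 2 \<longrightarrow> algebraic_connectivity (star_graph n) = 1))
   \<and> (\<forall>n k :: nat. 1 \<le> k \<and> k \<le> n - 1 \<longrightarrow>
        algebraic_connectivity (token_graph k (path_graph n))
          = algebraic_connectivity (path_graph n) \<and>
        algebraic_connectivity (path_graph n) = 2 * (1 - cos (pi / real n)))
   \<and> (\<forall>n1 n2 n k :: nat. 1 \<le> n1 \<and> n1 \<le> n2 \<and> n = n1 + n2 \<and> 1 \<le> k \<and> k \<le> n - 1 \<longrightarrow>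
        algebraic_connectivity (token_graph k (complete_bipartite_graph n1 n2))
          = algebraic_connectivity (complete_bipartite_graph n1 n2) \<and>
        ((n1, n2) \<noteq> (1, 1) \<longrightarrow>
          algebraic_connectivity (complete_bipartite_graph n1 n2) = real n1))"
proof -
  have bipartite: "algebraic_connectivity (token_graph k (complete_bipartite_graph n1 n2))
        = algebraic_connectivity (complete_bipartite_graph n1 n2) \<and>
      ((n1, n2) \<noteq> (1, 1) \<longrightarrow> algebraic_connectivity (complete_bipartite_graph n1 n2) = real n1)"
    if "1 \<le> n1" "n1 \<le> n2" "n = n1 + n2" "1 \<le> k" "k \<le> n - 1" for n1 n2 n k
  proof (cases "n2 = 1")
    case True
    then have mn: "n1 = 1" "n2 = 1" and k: "1 \<le> k" "k < 2" using that by auto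
    \<comment> \<open>The exceptional edge is handled as the complete graph on two vertices.\<close>
    have K2: "complete_bipartite_graph 1 1 = complete_graph 2"
      by (auto simp: complete_bipartite_graph_def complete_graph_def)
    show ?thesis
      unfolding mn K2 using algebraic_connectivity_complete_graph[OF k] by simp
  next
    case False
    with that show ?thesis
      using algebraic_connectivity_complete_bipartite_graph[of k n1 n2] by auto
  qed
  have less: "k < n" if "1 \<le> k" "k \<le> n - 1" for k n :: nat
    using that by simp
  have star: "algebraic_connectivity (token_graph k (star_graph n)) = algebraic_connectivity (star_graph n) \<and>
      (n \<noteq> 2 \<longrightarrow> algebraic_connectivity (star_graph n) = 1)"
    if "1 \<le> k" "k \<le> n - 1" for n k
    unfolding star_graph_def using bipartite[of 1 "n - 1" n k] that by auto
  have complete: "algebraic_connectivity (token_graph k (complete_graph n)) = algebraic_connectivity (complete_graph n)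
      \<and> algebraic_connectivity (complete_graph n) = real n" if "1 \<le> k" "k \<le> n - 1" for n k
    unfolding algebraic_connectivity_complete_graph[OF that(1) less[OF that]] by simp
  have path: "algebraic_connectivity (token_graph k (path_graph n)) = algebraic_connectivity (path_graph n)
      \<and> algebraic_connectivity (path_graph n) = 2 * (1 - cos (pi / real n))" if "1 \<le> k" "k \<le> n - 1" for n k
    unfolding algebraic_connectivity_path_graph[OF that(1) less[OF that]] by simp
  show ?thesis
    by (intro conjI; intro allI impI; elim conjE; rule complete star path bipartite; assumption)
qed

end
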